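(* The algorithm Marginal-Cost-Greedy-Young (defined in the context), on input a preference profile $P$ and a candidate $c$, runs in time $O(N^2\log N)$, where $N$ is the length of the input $(P,c)$.
   Context: Elections. $C=\{1,\ldots,m\}$ is the set of candidates, $\mathcal{L}(C)$ the set of all rankings (strict total orders) of $C$, and a preference profile with $n$ voters is a tuple $P=\langle >_1,\ldots,>_n\rangle\in\mathcal{L}(C)^n$ ($d>_i c$ means voter $i$ prefers $d$ to $c$). For distinct $c,d\in C$ the vote deficit of $c$ against $d$ is $\mathrm{Deficit}(P,c,d)=\max\{0,\ |\{i: d>_i c\}|-|\{i: c>_i d\}|\}$, and $\mathrm{Deficit}(P,c)=\sum_{d\in C\setminus\{c\}}\mathrm{Deficit}(P,c,d)$. Deletions. An edit is a map from preference profiles to preference profiles (possibly with a different number of voters); $P\circ e$ denotes the result of applying $e$ to $P$. A deletion is an edit designated by an index $i$ which sends $\langle >_1,\ldots,>_n\rangle$ to $\langle >_1,\ldots,>_{i-1},>_{i+1},\ldots,>_n\rangle$, i.e. removes the $i$-th voter. Deficit reductions. For a sequence of edits $S'=\langle e_1,\ldots,e_p\rangle$, let $D(P,c,S')$ be the sequence of all deficit reductions caused by applying $S'$ to $P$, i.e. there is one entry for each pair $(k,d)$ with $1\le k\le p$, $d\in C\setminus\{c\}$ and $\mathrm{Deficit}(P\circ e_1\circ\cdots\circ e_{k-1},c,d)>\mathrm{Deficit}(P\circ e_1\circ\cdots\circ e_k,c,d)$. $|D(P,c,S')|$ is its length. The marginal cost of $S'$ on $P$ is $|S'|/|D(P,c,S')|$,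 defined to be $\infty$ if $|D(P,c,S')|=0$. Algorithm Marginal-Cost-Greedy-Young. Input: a preference profile $P$ and a candidate $c$. Start with $S=\langle\rangle$. While $\mathrm{Deficit}(P,c)>0$: choose $S'=\langle e\rangle$ minimizing the marginal cost $|S'|/|D(P,c,S')|$ over all $S'\in\mathcal{E}''$, where $\mathcal{E}''$ is the collection of all single-element sequences of deletions on the current profile $P$ (ties broken arbitrarily); replace $P$ by $P\circ e$ and append $e$ to $S$. When the loop ends, output $|S|$. In an implementation, $\mathcal{E}''$ is maintained as a priority queue keyed by marginal cost. *)

theory Defs
  imports Complex_Main "HOL-Library.Extended_Real" "HOL-Library.Landau_Symbols"
    "HOL-Library.Discrete_Functions"
begin

section \<open>Elections\<close>

text \<open>The candidates are \<open>{1..m}\<close>. A ranking is a strict total order, given as a relation;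
  \<open>(d, c) \<in> r\<close> means that \<open>d\<close> is preferred to \<open>c\<close>. A profile is the list of the voters'
  rankings.\<close>

type_synonym ranking = "(nat \<times> nat) set"
type_synonym profile = "ranking list"

definition is_ranking :: "nat \<Rightarrow> ranking \<Rightarrow> bool" where
  "is_ranking m r \<longleftrightarrow> r \<subseteq> {1..m} \<times> {1..m} \<and> strict_linear_order_on {1..m} r"

definition is_profile :: "nat \<Rightarrow> profile \<Rightarrow> bool" where
  "is_profile m P \<longleftrightarrow> (\<forall>r \<in> set P. is_ranking m r)"

definition supporters :: "profile \<Rightarrow> nat \<Rightarrow> nat \<Rightarrow> nat" where
  "supporters P a b = card {i. i < length P \<and> (a, b) \<in> P ! i}"

definition pair_deficit :: "profile \<Rightarrow> nat \<Rightarrow> nat \<Rightarrow> int" where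
  "pair_deficit P c d = max 0 (int (supporters P d c) - int (supporters P c d))"

definition deficit :: "nat \<Rightarrow> profile \<Rightarrow> nat \<Rightarrow> int" where
  "deficit m P c = (\<Sum>d \<in> {1..m} - {c}. pair_deficit P c d)"


section \<open>Deletions and marginal cost\<close>

type_synonym edit = "profile \<Rightarrow> profile"

text \<open>Voters are numbered from 1; \<open>deletion i\<close> is meant for \<open>1 \<le> i \<le> length P\<close>.\<close>

definition deletion :: "nat \<Rightarrow> edit" where
  "deletion i P = take (i - 1) P @ drop i P"

definition apply_edits :: "profile \<Rightarrow> edit list \<Rightarrow> profile" where
  "apply_edits P es = foldl (\<lambda>Q e. e Q) P es"

definition reductions :: "nat \<Rightarrow> profile \<Rightarrow> nat \<Rightarrow> edit list \<Rightarrow> (nat \<times> nat) list" where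
  "reductions m P c es =
     [(k, d). k \<leftarrow> [1..<length es + 1], d \<leftarrow> [1..<m + 1],
        d \<noteq> c \<and>
        pair_deficit (apply_edits P (take (k - 1) es)) c d
          > pair_deficit (apply_edits P (take k es)) c d]"

definition marginal_cost :: "nat \<Rightarrow> profile \<Rightarrow> nat \<Rightarrow> edit list \<Rightarrow> ereal" where
  "marginal_cost m P c es =
     (if length (reductions m P c es) = 0 then \<infinity>
      else ereal (real (length es) / real (length (reductions m P c es))))"

definition single_deletions :: "profile \<Rightarrow> edit list set" where
  "single_deletions P = {[deletion i] | i. 1 \<le> i \<and> i \<le> length P}"


section \<open>Marginal-Cost-Greedy-Young\<close>

text \<open>\<open>greedy_young m c P S\<close>: some run of the algorithm on \<open>(P, c)\<close>, under some way of breaking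
  ties, ends with the sequence of deletions \<open>S\<close>, so that its output is \<open>length S\<close>. The entries of
  \<open>S\<close> are voter numbers relative to the profile that is current when the deletion is made.\<close>

inductive greedy_young :: "nat \<Rightarrow> nat \<Rightarrow> profile \<Rightarrow> nat list \<Rightarrow> bool" for m c where
  stop: "\<not> deficit m P c > 0 \<Longrightarrow> greedy_young m c P []"
| step: "\<lbrakk> deficit m P c > 0;
           1 \<le> i; i \<le> length P;
           \<forall>S' \<in> single_deletions P. marginal_cost m P c [deletion i] \<le> marginal_cost m P c S';
           greedy_young m c (deletion i P) S \<rbrakk>
         \<Longrightarrow> greedy_young m c P (i # S)"


section \<open>Random access machines\<close>

text \<open>Running time is measured on a random access machine with a read-only input tape, a
  write-only output tape and a memory of registers holding natural numbers, under the logarithmic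
  cost criterion of Aho, Hopcroft and Ullman: an instruction is charged the total bit size of all
  the addresses and values that its operands involve. Since every instruction costs at least 1, a
  bound on this cost also bounds the number of instructions executed. The arithmetic is addition
  and truncated subtraction, and the control flow is structured instead of by jumps.\<close>

definition bit_size :: "nat \<Rightarrow> nat" where
  "bit_size x = floor_log x + 1"

datatype loc = Dir nat | Ind nat

datatype opd = Const nat | Loc loc

datatype com =
    Skip
  | Read loc
  | Write opd
  | Move loc opd
  | Add loc opd opd
  | Sub loc opd opd
  | Seq com com
  | Cond opd com com
  | While opd com

type_synonym mem = "nat \<Rightarrow> nat"

fun addr :: "mem \<Rightarrow> loc \<Rightarrow> nat" where
  "addr M (Dir i) = i"
| "addr M (Ind i) = M i"

fun val :: "mem \<Rightarrow> opd \<Rightarrow> nat" where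
  "val M (Const k) = k"
| "val M (Loc l) = M (addr M l)"

fun loc_cost :: "mem \<Rightarrow> loc \<Rightarrow> nat" where
  "loc_cost M (Dir i) = bit_size i"
| "loc_cost M (Ind i) = bit_size i + bit_size (M i)"

fun opd_cost :: "mem \<Rightarrow> opd \<Rightarrow> nat" where
  "opd_cost M (Const k) = bit_size k"
| "opd_cost M (Loc l) = loc_cost M l + bit_size (M (addr M l))"

text \<open>A state consists of the memory, the unread part of the input tape, and the output written
  so far. \<open>exec p s t s'\<close>: started in \<open>s\<close>, the program \<open>p\<close> halts in \<open>s'\<close> at total cost \<open>t\<close>.
  Programs are deterministic; reading beyond the end of the input is an error, from which there is
  no halting.\<close>

type_synonym state = "mem \<times> nat list \<times> nat list"

inductive exec :: "com \<Rightarrow> state \<Rightarrow> nat \<Rightarrow> state \<Rightarrow> bool" where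
  Skip: "exec Skip s 1 s"
| Read: "exec (Read l) (M, x # xs, out) (loc_cost M l + bit_size x) (M(addr M l := x), xs, out)"
| Write: "exec (Write a) (M, inp, out) (opd_cost M a) (M, inp, out @ [val M a])"
| Move: "exec (Move l a) (M, inp, out) (loc_cost M l + opd_cost M a)
           (M(addr M l := val M a), inp, out)"
| Add: "exec (Add l a b) (M, inp, out) (loc_cost M l + opd_cost M a + opd_cost M b)
           (M(addr M l := val M a + val M b), inp, out)"
| Sub: "exec (Sub l a b) (M, inp, out) (loc_cost M l + opd_cost M a + opd_cost M b)
           (M(addr M l := val M a - val M b), inp, out)"
| Seq: "exec p s t s' \<Longrightarrow> exec q s' u s'' \<Longrightarrow> exec (Seq p q) s (t + u) s''"
| CondT: "val M a \<noteq> 0 \<Longrightarrow> exec p (M, inp, out) t s' \<Longrightarrow>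
           exec (Cond a p q) (M, inp, out) (opd_cost M a + t) s'"
| CondF: "val M a = 0 \<Longrightarrow> exec q (M, inp, out) t s' \<Longrightarrow>
           exec (Cond a p q) (M, inp, out) (opd_cost M a + t) s'"
| WhileF: "val M a = 0 \<Longrightarrow> exec (While a p) (M, inp, out) (opd_cost M a) (M, inp, out)"
| WhileT: "val M a \<noteq> 0 \<Longrightarrow> exec p (M, inp, out) t s' \<Longrightarrow> exec (While a p) s' u s'' \<Longrightarrow>
           exec (While a p) (M, inp, out) (opd_cost M a + t + u) s''"

definition initial :: "nat list \<Rightarrow> state" where
  "initial w = ((\<lambda>_. 0), w, [])"

definition printed :: "state \<Rightarrow> nat list" where
  "printed s = snd (snd s)"


section \<open>Input encoding\<close>

text \<open>A ranking is written as the list of all candidates from the most to the least preferred one: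
  the sorting key of \<open>d\<close> is the number of candidates preferred to \<open>d\<close>.\<close>

definition ranking_list :: "nat \<Rightarrow> ranking \<Rightarrow> nat list" where
  "ranking_list m r = sort_key (\<lambda>d. card {e. (e, d) \<in> r}) [1..<m + 1]"

definition encode :: "nat \<Rightarrow> profile \<Rightarrow> nat \<Rightarrow> nat list" where
  "encode m P c = [m, length P, c] @ concat (map (ranking_list m) P)"

definition input_length :: "nat list \<Rightarrow> nat" where
  "input_length w = (\<Sum>x \<leftarrow> w. bit_size x)"


section \<open>Implementations and their running time\<close>

text \<open>An implementation carries out a run of the algorithm: it reports the deletions
  it chooses, in order, and then the output of the algorithm, which is their number. Demanding the
  whole sequence excludes programs that obtain the number without following the greedy choices.\<close>

definition implements_greedy_young :: "com \<Rightarrow> bool" where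
  "implements_greedy_young p \<longleftrightarrow>
     (\<forall>m P c. is_profile m P \<and> c \<in> {1..m} \<longrightarrow>
        (\<exists>t s S. exec p (initial (encode m P c)) t s \<and>
           greedy_young m c P S \<and> printed s = S @ [length S]))"

definition runs_in_time :: "com \<Rightarrow> (nat \<Rightarrow> real) \<Rightarrow> bool" where
  "runs_in_time p T \<longleftrightarrow>
     (\<forall>m P c. is_profile m P \<and> c \<in> {1..m} \<longrightarrow>
        (\<exists>t s. exec p (initial (encode m P c)) t s \<and>
           real t \<le> T (input_length (encode m P c))))"

end

theory Submission imports Defs begin

text \<open>Deleting voter \<open>i\<close> reduces exactly those deficits that are positive and in which \<open>i\<close> sides
  against \<open>c\<close>. So a deletion of minimal marginal cost maximizes the number (the score of \<open>i\<close>) of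
  candidates \<open>d\<close> that \<open>i\<close> prefers to \<open>c\<close> and that a strict majority prefers to \<open>c\<close>, and the
  total deficit is positive iff some score is. With \<open>m\<close> candidates and \<open>n\<close> voters, recomputing all
  scores takes \<open>O(nm)\<close> instructions, and there are at most \<open>n\<close> rounds. For \<open>n > 0\<close> the input length is
  at least \<open>nm\<close>, so a random access machine executes \<open>O(N\<^sup>2)\<close> instructions on addresses and values
  of \<open>O(log N)\<close> bits; no priority queue is needed.\<close>

section \<open>The greedy choice\<close>

text \<open>Three obstacles shape the program and its analysis. The reported numbers refer to the
  current profile, so a deletion cannot merely mark a voter: all rows behind it move up by one,
  which keeps row numbers equal to voter numbers and costs no more than a rescan of the scores. The
  logarithmic criterion charges for addresses and values, so every statement about a program is
  relative to a number \<open>B\<close> that bounds all registers and unread inputs; the cost is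
  then the number of instructions times a multiple of \<open>bit_size B\<close>, and
  \<open>B\<close> can be chosen linear in \<open>n * m + m + n\<close>. Finally, without voters
  \<open>N\<close> may be of order \<open>log m\<close>, so that \<open>B\<close> is not polynomial
  in \<open>N\<close>; but then \<open>bit_size B\<close> is still linear in \<open>N\<close>, and
  only constantly many instructions are executed.\<close>

lemma supporters_filter: "supporters P a b = length (filter (\<lambda>r. (a, b) \<in> r) P)"
  by (simp add: supporters_def length_filter_conv_card)

lemma supporters_le_length: "supporters P a b \<le> length P"
  by (simp add: supporters_filter)

lemma length_deletion: "i < length P \<Longrightarrow> length (deletion (Suc i) P) = length P - 1"
  by (simp add: deletion_def)

lemma nth_deletion:
  "i < length P \<Longrightarrow> j < length P - 1 \<Longrightarrow>
     deletion (Suc i) P ! j = (if j < i then P ! j else P ! Suc j)"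
  by (auto simp: deletion_def nth_append)

lemma is_profile_deletion: "is_profile m P \<Longrightarrow> is_profile m (deletion i P)"
  by (auto simp: is_profile_def deletion_def dest: in_set_takeD in_set_dropD)

lemma supporters_deletion:
  assumes "i < length P"
  shows "supporters P a b = supporters (deletion (Suc i) P) a b + of_bool ((a, b) \<in> P ! i)"
proof -
  have "supporters P a b = supporters (take i P @ P ! i # drop (Suc i) P) a b"
    using id_take_nth_drop[OF assms] by simp
  then show ?thesis by (simp add: supporters_filter deletion_def)
qed

lemma is_ranking_asym:
  assumes "is_ranking m r" "a \<in> {1..m}" "b \<in> {1..m}" "a \<noteq> b"
  shows "(a, b) \<in> r \<longleftrightarrow> (b, a) \<notin> r"
  using assms unfolding is_ranking_def strict_linear_order_on_def total_on_def irrefl_def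
  by (blast dest: transD)

lemma supporters_add:
  assumes "is_profile m P" "a \<in> {1..m}" "b \<in> {1..m}" "a \<noteq> b"
  shows "supporters P a b + supporters P b a = length P"
proof -
  have "filter (\<lambda>r. (b, a) \<in> r) P = filter (\<lambda>r. (a, b) \<notin> r) P"
    using is_ranking_asym[OF _ assms(2-4)] assms(1)
    by (intro filter_cong) (simp_all add: is_profile_def)
  then show ?thesis by (simp add: supporters_filter sum_length_filter_compl)
qed

text \<open>The majority condition stands for a positive deficit against \<open>d\<close>: in a
  profile of rankings the supporters of both sides add up to \<open>length P\<close>, so the one
  counter stored by the program suffices. Irreflexivity rules out \<open>d = c\<close>.\<close>

definition gains :: "nat \<Rightarrow> profile \<Rightarrow> nat \<Rightarrow> nat \<Rightarrow> bool" where
  "gains c P i d \<longleftrightarrow> (d, c) \<in> P ! i \<and> length P < 2 * supporters P d c"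

text \<open>The number of candidates is an argument so that \<open>score j\<close> can serve as the
  partial sum after \<open>j\<close> columns in a loop invariant.\<close>

definition score :: "nat \<Rightarrow> nat \<Rightarrow> profile \<Rightarrow> nat \<Rightarrow> nat" where
  "score m c P i = (\<Sum>d = 1..m. of_bool (gains c P i d))"

lemma score_card: "score m c P i = card {d \<in> {1..m}. gains c P i d}"
  by (simp add: score_def Int_def)

lemma score_0: "score 0 c P i = 0"
  by (simp add: score_def)

lemma score_Suc: "score (Suc m) c P i = score m c P i + of_bool (gains c P i (Suc m))"
  by (simp add: score_def)

lemma score_le: "score m c P i \<le> m"
  using sum_mono[of "{1..m}" "\<lambda>d. of_bool (gains c P i d)" "\<lambda>_. 1::nat"] by (simp add: score_def)

section \<open>Deficits and marginal costs in terms of scores\<close>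

context
  fixes m c :: nat and P :: profile
  assumes P: "is_profile m P" and c: "c \<in> {1..m}"
begin

lemma pair_deficit_pos:
  assumes "d \<in> {1..m}" "d \<noteq> c"
  shows "pair_deficit P c d > 0 \<longleftrightarrow> length P < 2 * supporters P d c"
  using supporters_add[OF P assms(1) c assms(2)] by (auto simp: pair_deficit_def)

lemma irrefl_nth: "i < length P \<Longrightarrow> (c, c) \<notin> P ! i"
  using P by (auto simp: is_profile_def is_ranking_def strict_linear_order_on_def irrefl_def)

text \<open>Removing one ranking changes the difference of supporters by exactly one. Its truncation
  at 0 drops only if the difference was positive and the removed voter was on the side of
  \<open>d\<close>.\<close>

lemma pair_deficit_deletion_less:
  assumes "i < length P" "d \<in> {1..m}" "d \<noteq> c"
  shows "pair_deficit (deletion (Suc i) P) c d < pair_deficit P c d \<longleftrightarrow> gains c P i d"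
proof -
  have "is_ranking m (P ! i)" using P assms by (auto simp: is_profile_def)
  then have "(d, c) \<in> P ! i \<longleftrightarrow> (c, d) \<notin> P ! i" using is_ranking_asym assms c by metis
  moreover have "supporters P d c + supporters P c d = length P"
    using supporters_add[OF P assms(2) c assms(3)] .
  ultimately show ?thesis
    using supporters_deletion[OF assms(1), of c d] supporters_deletion[OF assms(1), of d c]
    unfolding gains_def pair_deficit_def by (cases "(d, c) \<in> P ! i") auto
qed

text \<open>A single edit leaves only \<open>k = 1\<close>, so each candidate contributes at most
  one entry and the length counts the candidates whose deficit drops.\<close>

lemma length_reductions_deletion:
  assumes "i < length P"
  shows "length (reductions m P c [deletion (Suc i)]) = score m c P i"
proof -
  let ?g = "\<lambda>d. d \<noteq> c \<and> pair_deficit (deletion (Suc i) P) c d < pair_deficit P c d"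
  have "reductions m P c [deletion (Suc i)] =
      concat (map (\<lambda>d. if ?g d then [(1, d)] else []) [1..<m + 1])"
  proof -
    have "[1..<length [deletion (Suc i)] + 1] = [1]" by simp
    then show ?thesis by (simp add: reductions_def apply_edits_def del: upt_Suc One_nat_def)
  qed
  moreover have "length (concat (map (\<lambda>d. if ?g d then [(1::nat, d)] else []) ds))
      = length (filter ?g ds)" for ds
    by (induction ds) auto
  moreover have "length (filter ?g [1..<m + 1]) = card {d \<in> {1..m}. ?g d}"
    by (simp add: distinct_length_filter Int_def conj_commute less_Suc_eq_le
        del: upt_Suc)
  moreover have "{d \<in> {1..m}. ?g d} = {d \<in> {1..m}. gains c P i d}"
    using pair_deficit_deletion_less[OF assms] irrefl_nth[OF assms] by (auto simp: gains_def)
  ultimately show ?thesis by (simp only: score_card)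
qed

lemma marginal_cost_deletion_mono:
  assumes "i < length P" "j < length P" "score m c P j \<le> score m c P i"
  shows "marginal_cost m P c [deletion (Suc i)] \<le> marginal_cost m P c [deletion (Suc j)]"
  using assms by (auto simp: marginal_cost_def length_reductions_deletion divide_simps)

text \<open>A strict majority against \<open>c\<close> is nonempty, so a positive deficit shows in
  the score of each of its voters. This lets the program test the best score instead of computing a
  deficit.\<close>

lemma deficit_pos_iff: "deficit m P c > 0 \<longleftrightarrow> (\<exists>i < length P. score m c P i > 0)"
proof -
  have nonneg: "pair_deficit P c d \<ge> 0" for d by (simp add: pair_deficit_def)
  have "deficit m P c > 0 \<longleftrightarrow> (\<exists>d \<in> {1..m} - {c}. pair_deficit P c d > 0)"
    using sum_nonneg_eq_0_iff[of "{1..m} - {c}" "pair_deficit P c"] nonneg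
      sum_nonneg[of "{1..m} - {c}" "pair_deficit P c"]
    unfolding deficit_def by (auto simp: less_le)
  also have "\<dots> \<longleftrightarrow> (\<exists>d \<in> {1..m} - {c}. length P < 2 * supporters P d c)"
    using pair_deficit_pos by auto
  also have "\<dots> \<longleftrightarrow> (\<exists>d \<in> {1..m}. \<exists>i < length P. gains c P i d)"
  proof -
    have "(\<exists>i < length P. (d, c) \<in> P ! i)" if "length P < 2 * supporters P d c" for d
    proof -
      from that have "{i. i < length P \<and> (d, c) \<in> P ! i} \<noteq> {}"
        by (metis card.empty mult_0_right not_less0 supporters_def)
      then show ?thesis by auto
    qed
    then show ?thesis using irrefl_nth unfolding gains_def by blast
  qed
  also have "\<dots> \<longleftrightarrow> (\<exists>i < length P. score m c P i > 0)"
    unfolding score_card card_gt_0_iff by fastforce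
  finally show ?thesis .
qed

lemma greedy_young_step:
  assumes "i < length P" "score m c P i > 0" "\<forall>j < length P. score m c P j \<le> score m c P i"
    and "greedy_young m c (deletion (Suc i) P) S"
  shows "greedy_young m c P (Suc i # S)"
proof (rule greedy_young.step)
  show "deficit m P c > 0" using deficit_pos_iff assms by blast
  show "\<forall>S' \<in> single_deletions P. marginal_cost m P c [deletion (Suc i)] \<le> marginal_cost m P c S'"
  proof
    fix S' assume "S' \<in> single_deletions P"
    then obtain j where "j < length P" "S' = [deletion (Suc j)]"
      unfolding single_deletions_def by (auto simp: Suc_le_eq) (metis Suc_pred less_eq_Suc_le)
    then show "marginal_cost m P c [deletion (Suc i)] \<le> marginal_cost m P c S'"
      using marginal_cost_deletion_mono assms by auto
  qed
qed (use assms in auto)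

end

section \<open>Ranking lists\<close>

lemma length_ranking_list: "length (ranking_list m r) = m"
  by (simp add: ranking_list_def)

lemma set_ranking_list: "set (ranking_list m r) = {1..m}"
  by (auto simp: ranking_list_def)

lemma distinct_ranking_list: "distinct (ranking_list m r)"
  by (simp add: ranking_list_def)

text \<open>By transitivity whatever is above \<open>x\<close> is above everything below
  \<open>x\<close>, and \<open>x\<close> itself makes the inclusion of the upper sets proper. Hence
  the sorting key is strictly monotone along \<open>r\<close>.\<close>

lemma prefers_iff_card_less:
  assumes r: "is_ranking m r" and a: "a \<in> {1..m}" and b: "b \<in> {1..m}"
  shows "(a, b) \<in> r \<longleftrightarrow> card {e. (e, a) \<in> r} < card {e. (e, b) \<in> r}"
proof -
  have tr: "trans r" and ir: "irrefl r" and sub: "r \<subseteq> {1..m} \<times> {1..m}"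
    using r by (auto simp: is_ranking_def strict_linear_order_on_def)
  have less: "card {e. (e, x) \<in> r} < card {e. (e, y) \<in> r}" if "(x, y) \<in> r" for x y
  proof (rule psubset_card_mono)
    show "finite {e. (e, y) \<in> r}"
      by (rule finite_subset[of _ "{1..m}"]) (use sub in auto)
    show "{e. (e, x) \<in> r} \<subset> {e. (e, y) \<in> r}"
      using that tr ir by (auto simp: psubset_eq irrefl_def dest: transD)
  qed
  have "a = b \<or> (a, b) \<in> r \<or> (b, a) \<in> r" using is_ranking_asym[OF r a b] by blast
  then show ?thesis using less[of a b] less[of b a] ir by (auto simp: irrefl_def)
qed

text \<open>Both sides say that position \<open>j\<close> comes before the position of
  \<open>c\<close>. The prefix includes position \<open>j\<close>, so a flag that is cleared as soon
  as \<open>c\<close> is read gives the right table entry for every candidate, \<open>c\<close>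
  included.\<close>

lemma ranking_list_prefers_iff:
  assumes r: "is_ranking m r" and c: "c \<in> {1..m}" and j: "j < m"
  shows "(ranking_list m r ! j, c) \<in> r \<longleftrightarrow> c \<notin> set (take (Suc j) (ranking_list m r))"
proof -
  let ?xs = "ranking_list m r" and ?f = "\<lambda>d. card {e. (e, d) \<in> r}"
  have sorted: "sorted (map ?f ?xs)" by (simp add: ranking_list_def)
  have iff: "(?xs ! a, ?xs ! b) \<in> r \<longleftrightarrow> ?f (?xs ! a) < ?f (?xs ! b)" if "a < m" "b < m" for a b
    using prefers_iff_card_less[OF r] that set_ranking_list nth_mem length_ranking_list by metis
  obtain k where k: "k < m" "?xs ! k = c"
    using c set_ranking_list in_set_conv_nth length_ranking_list by metis
  have "(?xs ! j, c) \<in> r \<longleftrightarrow> j < k"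
  proof
    assume "(?xs ! j, c) \<in> r"
    then have "?f (?xs ! j) < ?f (?xs ! k)" using iff j k by metis
    then show "j < k"
      using sorted_nth_mono[OF sorted, of k j] j by (force simp: length_ranking_list)
  next
    assume "j < k"
    then have "?xs ! j \<noteq> ?xs ! k"
      using distinct_ranking_list[of m r] j k(1) nth_eq_iff_index_eq[of ?xs j k]
      by (simp add: length_ranking_list)
    moreover have "?xs ! j \<in> {1..m}" using j set_ranking_list nth_mem length_ranking_list by metis
    moreover have "(?xs ! k, ?xs ! j) \<notin> r"
      using sorted_nth_mono[OF sorted, of j k] \<open>j < k\<close> k iff[of k j] j by (simp add: length_ranking_list)
    ultimately show "(?xs ! j, c) \<in> r" using is_ranking_asym[OF r _ c] k by metis
  qed
  also have "\<dots> \<longleftrightarrow> c \<notin> set (take (Suc j) ?xs)"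
  proof
    assume "j < k"
    show "c \<notin> set (take (Suc j) ?xs)"
    proof
      assume "c \<in> set (take (Suc j) ?xs)"
      then obtain l where "l < Suc j" "?xs ! l = c" "l < m"
        by (auto simp: in_set_conv_nth length_ranking_list)
      then show False
        using k(1) k(2)[symmetric] \<open>j < k\<close> distinct_ranking_list[of m r]
          nth_eq_iff_index_eq[of ?xs l k] by (simp add: length_ranking_list)
    qed
  next
    assume *: "c \<notin> set (take (Suc j) ?xs)"
    show "j < k"
    proof (rule ccontr)
      assume "\<not> j < k"
      then have "take (Suc j) ?xs ! k \<in> set (take (Suc j) ?xs)"
        using j by (intro nth_mem) (simp add: length_ranking_list)
      with * k \<open>\<not> j < k\<close> show False by simp
    qed
  qed
  finally show ?thesis .
qed

section \<open>Bounding the cost of a program\<close>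

definition bounded :: "nat \<Rightarrow> state \<Rightarrow> bool" where
  "bounded B s \<longleftrightarrow> (\<forall>x. fst s x \<le> B) \<and> (\<forall>x \<in> set (fst (snd s)). x \<le> B)"

text \<open>A single instruction involves at most eight addresses and values, hence the unit of cost.\<close>

definition run :: "nat \<Rightarrow> com \<Rightarrow> state \<Rightarrow> nat \<Rightarrow> (state \<Rightarrow> bool) \<Rightarrow> bool" where
  "run B p s k Q \<longleftrightarrow> (bounded B s \<longrightarrow>
     (\<exists>t s'. exec p s t s' \<and> t \<le> k * (8 * bit_size B) \<and> bounded B s' \<and> Q s'))"

lemma run_mono:
  "run B p s k Q \<Longrightarrow> k \<le> k' \<Longrightarrow> (\<And>s'. Q s' \<Longrightarrow> Q' s') \<Longrightarrow> run B p s k' Q'"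
  unfolding run_def by (meson le_trans mult_le_mono1)

lemma run_Seq:
  assumes "run B p s k R" "\<And>s'. R s' \<Longrightarrow> run B q s' l Q"
  shows "run B (Seq p q) s (k + l) Q"
  using assms unfolding run_def by (fastforce simp: add_mult_distrib intro: exec.Seq add_mono)

lemma bit_size_mono: "x \<le> y \<Longrightarrow> bit_size x \<le> bit_size y"
  by (simp add: bit_size_def floor_log_le_iff)

lemma bit_size_pos: "bit_size x \<ge> 1"
  by (simp add: bit_size_def)

section \<open>Cost of loop-free programs\<close>

fun loc_const :: "loc \<Rightarrow> nat" where
  "loc_const (Dir i) = i"
| "loc_const (Ind i) = i"

fun opd_const :: "opd \<Rightarrow> nat" where
  "opd_const (Const i) = i"
| "opd_const (Loc l) = loc_const l"

text \<open>Constants and register numbers in the program text are charged as well, but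
  \<open>bounded\<close> says nothing about them. The largest one in the program is 16.\<close>

fun consts_le :: "nat \<Rightarrow> com \<Rightarrow> bool" where
  "consts_le B Skip = True"
| "consts_le B (Read l) = (loc_const l \<le> B)"
| "consts_le B (Write a) = (opd_const a \<le> B)"
| "consts_le B (Move l a) = (loc_const l \<le> B \<and> opd_const a \<le> B)"
| "consts_le B (Add l a b) = (loc_const l \<le> B \<and> opd_const a \<le> B \<and> opd_const b \<le> B)"
| "consts_le B (Sub l a b) = (loc_const l \<le> B \<and> opd_const a \<le> B \<and> opd_const b \<le> B)"
| "consts_le B (Seq p q) = (consts_le B p \<and> consts_le B q)"
| "consts_le B (Cond a p q) = (opd_const a \<le> B \<and> consts_le B p \<and> consts_le B q)"
| "consts_le B (While a p) = (opd_const a \<le> B \<and> consts_le B p)"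

lemma consts_le_mono: "consts_le A p \<Longrightarrow> A \<le> B \<Longrightarrow> consts_le B p"
  by (induction p) auto

lemma loc_cost_le:
  assumes "\<forall>x. M x \<le> B" "loc_const l \<le> B"
  shows "loc_cost M l \<le> 2 * bit_size B"
  using assms bit_size_mono[of _ B] bit_size_pos[of B]
  by (cases l) (auto intro: add_mono simp: mult_2 intro: trans_le_add1)

lemma opd_cost_le:
  assumes "\<forall>x. M x \<le> B" "opd_const a \<le> B"
  shows "opd_cost M a \<le> 3 * bit_size B"
proof (cases a)
  case (Const x1)
  then show ?thesis using assms bit_size_mono[of x1 B] by simp
next
  case (Loc l)
  then show ?thesis using assms loc_cost_le[of M B l] bit_size_mono[of "M (addr M l)" B] by simp
qed

text \<open>A weakest precondition for loop-free programs. The number is a supply of credits, one of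
  which pays for one instruction. Bounds on values are only demanded where they can grow.\<close>

fun wp :: "nat \<Rightarrow> com \<Rightarrow> (nat \<Rightarrow> state \<Rightarrow> bool) \<Rightarrow> nat \<Rightarrow> state \<Rightarrow> bool" where
  "wp B Skip Q k s = (0 < k \<and> Q (k - 1) s)"
| "wp B (Read l) Q k (M, inp, out) =
     (0 < k \<and> inp \<noteq> [] \<and> Q (k - 1) (M(addr M l := hd inp), tl inp, out))"
| "wp B (Write a) Q k (M, inp, out) = (0 < k \<and> Q (k - 1) (M, inp, out @ [val M a]))"
| "wp B (Move l a) Q k (M, inp, out) = (0 < k \<and> Q (k - 1) (M(addr M l := val M a), inp, out))"
| "wp B (Add l a b) Q k (M, inp, out) =
     (0 < k \<and> val M a + val M b \<le> B \<and> Q (k - 1) (M(addr M l := val M a + val M b), inp, out))"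
| "wp B (Sub l a b) Q k (M, inp, out) =
     (0 < k \<and> Q (k - 1) (M(addr M l := val M a - val M b), inp, out))"
| "wp B (Seq p q) Q k s = wp B p (wp B q Q) k s"
| "wp B (Cond a p q) Q k (M, inp, out) =
     (0 < k \<and> (if val M a \<noteq> 0 then wp B p Q (k - 1) (M, inp, out)
                else wp B q Q (k - 1) (M, inp, out)))"
| "wp B (While a p) Q k s = False"

text \<open>The postcondition receives the credits \<open>l\<close> that are left over, so the
  second half of a \<open>Seq\<close> continues with what the first half has not spent; the cost is
  charged to the difference \<open>k - l\<close>.\<close>

lemma wp_sound:
  assumes "wp B p Q k s" "bounded B s" "consts_le B p"
  shows "\<exists>t s' l. exec p s t s' \<and> l \<le> k \<and> t \<le> (k - l) * (8 * bit_size B) \<and> bounded B s' \<and> Q l s'"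
  using assms
proof (induction p arbitrary: Q k s)
  case Skip
  then show ?case
    using exec.Skip[of s] bit_size_pos[of B] by (intro exI[of _ 1] exI[of _ s] exI[of _ "k - 1"]) auto
next
  case (Read l)
  obtain M inp out where s: "s = (M, inp, out)" by (cases s)
  with Read obtain x xs where inp: "inp = x # xs" by (cases inp) auto
  have "bit_size x \<le> bit_size B" "loc_cost M l \<le> 2 * bit_size B"
    using Read s inp by (auto simp: bounded_def intro: bit_size_mono loc_cost_le)
  then show ?case
    using Read s inp exec.Read[of l M x xs out]
    by (intro exI[of _ "loc_cost M l + bit_size x"] exI[of _ "(M(addr M l := x), xs, out)"]
        exI[of _ "k - 1"]) (auto simp: bounded_def)
next
  case (Write a)
  obtain M inp out where s: "s = (M, inp, out)" by (cases s)
  have "opd_cost M a \<le> 3 * bit_size B"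
    using Write s by (auto simp: bounded_def intro: opd_cost_le)
  then show ?case
    using Write s exec.Write[of a M inp out]
    by (intro exI[of _ "opd_cost M a"] exI[of _ "(M, inp, out @ [val M a])"]
        exI[of _ "k - 1"]) (auto simp: bounded_def)
next
  case (Move l a)
  obtain M inp out where s: "s = (M, inp, out)" by (cases s)
  have "opd_cost M a \<le> 3 * bit_size B" "loc_cost M l \<le> 2 * bit_size B"
    using Move s by (auto simp: bounded_def intro: opd_cost_le loc_cost_le)
  moreover have "val M a \<le> B" using Move s by (cases a) (auto simp: bounded_def)
  ultimately show ?case
    using Move s exec.Move[of l a M inp out]
    by (intro exI[of _ "loc_cost M l + opd_cost M a"] exI[of _ "(M(addr M l := val M a), inp, out)"]
        exI[of _ "k - 1"]) (auto simp: bounded_def)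
next
  case (Add l a b)
  obtain M inp out where s: "s = (M, inp, out)" by (cases s)
  have "opd_cost M a \<le> 3 * bit_size B" "opd_cost M b \<le> 3 * bit_size B" "loc_cost M l \<le> 2 * bit_size B"
    using Add s by (auto simp: bounded_def intro: opd_cost_le loc_cost_le)
  then show ?case
    using Add s exec.Add[of l a b M inp out]
    by (intro exI[of _ "loc_cost M l + opd_cost M a + opd_cost M b"]
        exI[of _ "(M(addr M l := val M a + val M b), inp, out)"] exI[of _ "k - 1"])
      (auto simp: bounded_def)
next
  case (Sub l a b)
  obtain M inp out where s: "s = (M, inp, out)" by (cases s)
  have "opd_cost M a \<le> 3 * bit_size B" "opd_cost M b \<le> 3 * bit_size B" "loc_cost M l \<le> 2 * bit_size B"
    using Sub s by (auto simp: bounded_def intro: opd_cost_le loc_cost_le)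
  moreover have "val M a \<le> B" using Sub s by (cases a) (auto simp: bounded_def)
  ultimately show ?case
    using Sub s exec.Sub[of l a b M inp out]
    by (intro exI[of _ "loc_cost M l + opd_cost M a + opd_cost M b"]
        exI[of _ "(M(addr M l := val M a - val M b), inp, out)"] exI[of _ "k - 1"])
      (auto simp: bounded_def)
next
  case (Seq p q)
  from Seq.IH(1)[of "wp B q Q" k s] Seq.prems obtain t s' l where 1:
    "exec p s t s'" "l \<le> k" "t \<le> (k - l) * (8 * bit_size B)" "bounded B s'" "wp B q Q l s'" by auto
  from Seq.IH(2)[of Q l s'] Seq.prems 1 obtain u s'' l' where 2:
    "exec q s' u s''" "l' \<le> l" "u \<le> (l - l') * (8 * bit_size B)" "bounded B s''" "Q l' s''" by auto
  have "t + u \<le> ((k - l) + (l - l')) * (8 * bit_size B)"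
    using 1 2 unfolding add_mult_distrib by linarith
  with 1 2 show ?case by (intro exI[of _ "t + u"] exI[of _ s''] exI[of _ l']) (auto intro: exec.Seq)
next
  case (Cond a p q)
  obtain M inp out where s: "s = (M, inp, out)" by (cases s)
  have cost: "opd_cost M a \<le> 3 * bit_size B"
    using Cond s by (auto simp: bounded_def intro: opd_cost_le)
  have "\<exists>t s' l. exec (if val M a \<noteq> 0 then p else q) s t s' \<and> l \<le> k - 1 \<and>
      t \<le> (k - 1 - l) * (8 * bit_size B) \<and> bounded B s' \<and> Q l s'"
    using Cond.IH(1)[of Q "k - 1" s] Cond.IH(2)[of Q "k - 1" s] Cond.prems s
    by (auto split: if_splits)
  then obtain t s' l where 1: "exec (if val M a \<noteq> 0 then p else q) s t s'" "l \<le> k - 1"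
      "t \<le> (k - 1 - l) * (8 * bit_size B)" "bounded B s'" "Q l s'" by auto
  have "exec (Cond a p q) s (opd_cost M a + t) s'"
    using 1(1) s by (auto intro: exec.CondT exec.CondF split: if_splits)
  moreover have "k - l = Suc (k - 1 - l)" using 1(2) Cond.prems s by auto
  then have "opd_cost M a + t \<le> (k - l) * (8 * bit_size B)" using 1(3) cost by simp
  ultimately show ?case using 1 by (intro exI[of _ "opd_cost M a + t"] exI[of _ s'] exI[of _ l]) auto
next
  case (While a p)
  then show ?case by simp
qed

lemma run_wp:
  assumes "consts_le 16 p" "16 \<le> B" "wp B p (\<lambda>_. Q) k s"
  shows "run B p s k Q"
  unfolding run_def
proof
  assume "bounded B s"
  with wp_sound[OF assms(3)] consts_le_mono[OF assms(1,2)] obtain t s' l where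
    "exec p s t s'" "t \<le> (k - l) * (8 * bit_size B)" "bounded B s'" "Q s'" by blast
  moreover have "(k - l) * (8 * bit_size B) \<le> k * (8 * bit_size B)" by simp
  ultimately show "\<exists>t s'. exec p s t s' \<and> t \<le> k * (8 * bit_size B) \<and> bounded B s' \<and> Q s'"
    by (meson le_trans)
qed

section \<open>Cost of loops\<close>

lemma run_WhileF:
  assumes "val M a = 0" "opd_const a \<le> B" "Q (M, inp, out)"
  shows "run B (While a p) (M, inp, out) 1 Q"
  unfolding run_def
proof
  assume b: "bounded B (M, inp, out)"
  then have "opd_cost M a \<le> 1 * (8 * bit_size B)"
    using opd_cost_le[of M B a] assms by (simp add: bounded_def)
  then show "\<exists>t s'. exec (While a p) (M, inp, out) t s' \<and> t \<le> 1 * (8 * bit_size B) \<and>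
      bounded B s' \<and> Q s'"
    using assms b exec.WhileF by blast
qed

lemma run_WhileT:
  assumes a: "val M a \<noteq> 0" "opd_const a \<le> B"
    and p: "run B p (M, inp, out) k R"
    and w: "\<And>s'. R s' \<Longrightarrow> run B (While a p) s' l Q"
  shows "run B (While a p) (M, inp, out) (k + 1 + l) Q"
  unfolding run_def
proof
  assume b: "bounded B (M, inp, out)"
  then have cost: "opd_cost M a \<le> 8 * bit_size B"
    using opd_cost_le[of M B a] a by (simp add: bounded_def)
  from p b obtain t s' where 1: "exec p (M, inp, out) t s'" "t \<le> k * (8 * bit_size B)"
    "bounded B s'" "R s'" unfolding run_def by blast
  from w[OF 1(4)] 1(3) obtain u s'' where 2: "exec (While a p) s' u s''" "u \<le> l * (8 * bit_size B)"
    "bounded B s''" "Q s''" unfolding run_def by blast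
  have "opd_cost M a + t + u \<le> (k + 1 + l) * (8 * bit_size B)"
    using cost 1 2 unfolding add_mult_distrib by linarith
  then show "\<exists>t s'. exec (While a p) (M, inp, out) t s' \<and> t \<le> (k + 1 + l) * (8 * bit_size B) \<and>
      bounded B s' \<and> Q s'"
    using exec.WhileT[OF a(1) 1(1) 2(1)] 2 by blast
qed

text \<open>Every loop except the outermost counts a register down to 0. Each iteration pays
  \<open>k\<close> for the body and 1 for the test, and the final 1 pays for the failing test. The
  induction is on the iterations left.\<close>

lemma run_for:
  assumes "x \<le> B" and init: "I 0 s"
    and counter: "\<And>i M inp out. i \<le> n \<Longrightarrow> I i (M, inp, out) \<Longrightarrow> M x = n - i"
    and body: "\<And>i M inp out. i < n \<Longrightarrow> I i (M, inp, out) \<Longrightarrow> run B p (M, inp, out) k (I (Suc i))"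
  shows "run B (While (Loc (Dir x)) p) s (n * (k + 1) + 1) (I n)"
proof -
  have "run B (While (Loc (Dir x)) p) s (l * (k + 1) + 1) (I n)" if "I (n - l) s" "l \<le> n" for l s
    using that
  proof (induction l arbitrary: s)
    case 0
    then obtain M inp out where "s = (M, inp, out)" by (cases s)
    moreover from this 0 counter[of n M inp out] have "M x = 0" by simp
    ultimately show ?case using 0 assms(1) run_WhileF[of M "Loc (Dir x)" B "I n" inp out p] by simp
  next
    case (Suc l)
    then obtain M inp out where s: "s = (M, inp, out)" by (cases s)
    with Suc.prems counter[of "n - Suc l" M inp out] have "val M (Loc (Dir x)) \<noteq> 0" by simp
    moreover have "run B p s k (I (n - l))"
      using body[of "n - Suc l" M inp out] Suc.prems s by (simp add: Suc_diff_Suc)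
    ultimately have "run B (While (Loc (Dir x)) p) s (k + 1 + (l * (k + 1) + 1)) (I n)"
      unfolding s using Suc.IH Suc.prems(2) assms(1)
      by (intro run_WhileT[where R = "I (n - l)"]) simp_all
    then show ?case by (simp add: algebra_simps)
  qed
  from this[of n s] init show ?thesis by simp
qed

section \<open>The program\<close>

text \<open>The registers 2 to 15 hold scalars. From address 16 on, the memory holds a table with rows of
  length \<open>m\<close>, addressed by columns \<open>1..m\<close>: row 0 contains the numbers of voters who prefer
  \<open>d\<close> to \<open>c\<close>, and row \<open>i\<close> tells whether voter \<open>i\<close> does.\<close>

definition cell :: "nat \<Rightarrow> nat \<Rightarrow> nat \<Rightarrow> nat" where
  "cell m i d = 16 + i * m + d"

abbreviation (input) "r_m \<equiv> 2"
abbreviation (input) "r_n \<equiv> 3"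
abbreviation (input) "r_c \<equiv> 4"
abbreviation (input) "r_i \<equiv> 5"
abbreviation (input) "r_j \<equiv> 6"
abbreviation (input) "r_p \<equiv> 7"
abbreviation (input) "r_q \<equiv> 8"
abbreviation (input) "r_w \<equiv> 9"
abbreviation (input) "r_t \<equiv> 10"
abbreviation (input) "r_s \<equiv> 11"
abbreviation (input) "r_best \<equiv> 12"
abbreviation (input) "r_index \<equiv> 13"
abbreviation (input) "r_row \<equiv> 14"
abbreviation (input) "r_count \<equiv> 15"

abbreviation (input) R :: "nat \<Rightarrow> opd" where "R i \<equiv> Loc (Dir i)"
abbreviation (input) At :: "nat \<Rightarrow> opd" where "At i \<equiv> Loc (Ind i)"

notation Seq (infixr ";;" 60)

text \<open>\<open>r_t\<close> is zero iff the candidate that was read is \<open>c\<close>, and \<open>r_s\<close> tells whether \<open>c\<close> has not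
  been read yet in the current ranking.\<close>

definition read_entry :: com where
  "read_entry =
     Read (Dir r_w);;
     Sub (Dir r_t) (R r_w) (R r_c);; Sub (Dir r_q) (R r_c) (R r_w);; Add (Dir r_t) (R r_t) (R r_q);;
     Cond (R r_t) Skip (Move (Dir r_s) (Const 0));;
     Add (Dir r_q) (R r_p) (R r_w);; Move (Ind r_q) (R r_s);;
     Add (Dir r_q) (R r_w) (Const 16);; Add (Ind r_q) (At r_q) (R r_s);;
     Sub (Dir r_j) (R r_j) (Const 1)"

definition read_ranking :: com where
  "read_ranking =
     (Move (Dir r_s) (Const 1);; Move (Dir r_j) (R r_m));;
     While (R r_j) read_entry;;
     (Add (Dir r_p) (R r_p) (R r_m);; Sub (Dir r_i) (R r_i) (Const 1))"

definition read_input :: com where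
  "read_input =
     (Read (Dir r_m);; Read (Dir r_n);; Read (Dir r_c);;
      Add (Dir r_p) (R r_m) (Const 16);; Move (Dir r_i) (R r_n));;
     While (R r_i) read_ranking"

text \<open>The truncated difference of twice the counter and the number of voters is nonzero
  exactly for a strict majority. \<open>r_w\<close> and \<open>r_q\<close> walk in parallel along
  row 0 and the row of the voter.\<close>

definition score_entry :: com where
  "score_entry =
     Add (Dir r_w) (R r_w) (Const 1);; Add (Dir r_q) (R r_q) (Const 1);;
     Add (Dir r_t) (At r_w) (At r_w);; Sub (Dir r_t) (R r_t) (R r_n);;
     Cond (R r_t) (Add (Dir r_s) (R r_s) (At r_q)) Skip;;
     Sub (Dir r_j) (R r_j) (Const 1)"

text \<open>The test for improvement is strict, so \<open>r_best\<close> stays 0 when no score is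
  positive. After the inner loop \<open>r_q\<close> is at the end of the row, which is the base of
  the next row and becomes the new \<open>r_p\<close>.\<close>

definition score_voter :: com where
  "score_voter =
     (Move (Dir r_s) (Const 0);; Move (Dir r_w) (Const 16);; Move (Dir r_q) (R r_p);;
      Move (Dir r_j) (R r_m));;
     While (R r_j) score_entry;;
     (Sub (Dir r_t) (R r_s) (R r_best);; Sub (Dir r_i) (R r_i) (Const 1);;
      Cond (R r_t)
        (Move (Dir r_best) (R r_s);; Sub (Dir r_index) (R r_n) (R r_i);; Move (Dir r_row) (R r_p))
        Skip;;
      Move (Dir r_p) (R r_q))"

definition choose_voter :: com where
  "choose_voter =
     (Move (Dir r_best) (Const 0);; Add (Dir r_p) (R r_m) (Const 16);; Move (Dir r_i) (R r_n));;
     While (R r_i) score_voter"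

definition subtract_entry :: com where
  "subtract_entry =
     Add (Dir r_w) (R r_w) (Const 1);; Add (Dir r_q) (R r_q) (Const 1);;
     Sub (Ind r_w) (At r_w) (At r_q);;
     Sub (Dir r_j) (R r_j) (Const 1)"

text \<open>The rows are contiguous, so moving all later rows up is a single copy loop over cells,
  without a nested loop over rows.\<close>

definition shift_entry :: com where
  "shift_entry =
     Add (Dir r_row) (R r_row) (Const 1);; Add (Dir r_q) (R r_q) (Const 1);;
     Move (Ind r_row) (At r_q);;
     Sub (Dir r_j) (R r_j) (Const 1)"

text \<open>\<open>choose_voter\<close> leaves \<open>r_p\<close> at the last address of the table,
  and the subtraction loop leaves \<open>r_q\<close> at the last address of the deleted row. Their
  difference is the number of cells to move.\<close>

definition delete_voter :: com where
  "delete_voter =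
     (Write (R r_index);; Add (Dir r_count) (R r_count) (Const 1);;
      Move (Dir r_w) (Const 16);; Move (Dir r_q) (R r_row);; Move (Dir r_j) (R r_m));;
     While (R r_j) subtract_entry;;
     (Sub (Dir r_j) (R r_p) (R r_q);; Sub (Dir r_n) (R r_n) (Const 1));;
     While (R r_j) shift_entry"

definition program :: com where
  "program =
     read_input;; choose_voter;;
     While (R r_best) (delete_voter;; choose_voter);;
     Write (R r_count)"

section \<open>Address arithmetic of the table\<close>

text \<open>Columns start at 1, and \<open>cell m (Suc i) 0\<close> is the last cell of row
  \<open>i\<close>; distinct pairs have distinct addresses only within the columns
  \<open>1..m\<close>. Loops use column 0 as the start value of a pointer that is incremented before
  each access.\<close>

lemma cell_eq_iff:
  assumes "d \<in> {1..m}" "d' \<in> {1..m}"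
  shows "cell m i d = cell m i' d' \<longleftrightarrow> i = i' \<and> d = d'"
proof
  assume eq: "cell m i d = cell m i' d'"
  have False if "i < i'" "d \<in> {1..m}" "d' \<in> {1..m}" "i * m + d = i' * m + d'" for i i' d d'
  proof -
    have "i * m + m \<le> i' * m" using mult_le_mono1[of "Suc i" i' m] that(1) by simp
    with that show False by simp
  qed
  from this[of i i' d d'] this[of i' i d' d] eq assms have "i = i'"
    unfolding cell_def by (metis add.assoc add_left_cancel linorder_neqE_nat)
  with eq show "i = i' \<and> d = d'" by (simp add: cell_def)
qed (simp)

lemma cell_neq: "x < 16 \<Longrightarrow> (cell m i d = x) = False" "x < 16 \<Longrightarrow> (x = cell m i d) = False"
  by (auto simp: cell_def)

lemma cell_le: "i \<le> k \<Longrightarrow> d \<le> m \<Longrightarrow> cell m i d \<le> 16 + (k + 1) * m"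
  using mult_le_mono1[of i k m] unfolding cell_def add_mult_distrib by linarith

lemma cell_le_row: "k < k' \<Longrightarrow> d \<le> m \<Longrightarrow> cell m k d \<le> cell m k' 0"
  using mult_le_mono1[of "Suc k" k' m] by (simp add: cell_def)

lemma cell_add: "cell m i a + b = cell m i (a + b)"
  by (simp add: cell_def)

lemma Suc_cell: "Suc (cell m i a) = cell m i (Suc a)"
  by (simp add: cell_def)

text \<open>Rows beyond \<open>length P\<close> are left unspecified: after deletions they contain
  leftovers.\<close>

definition table :: "nat \<Rightarrow> nat \<Rightarrow> profile \<Rightarrow> mem \<Rightarrow> bool" where
  "table m c P M \<longleftrightarrow> (\<forall>d \<in> {1..m}. M (cell m 0 d) = supporters P d c \<and>
     (\<forall>i < length P. M (cell m (Suc i) d) = of_bool ((d, c) \<in> P ! i)))"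

lemma table_cong:
  assumes "table m c P M" "\<And>a. 16 \<le> a \<Longrightarrow> M' a = M a"
  shows "table m c P M'"
  using assms by (simp add: table_def cell_def)

text \<open>\<open>n\<close> is the number of voters in the input, while later profiles are shorter.
  The first bound on \<open>B\<close> covers addresses; the second covers the doubled counters, the
  scores and the number of deletions.\<close>

locale machine =
  fixes m c n B :: nat
  assumes c: "c \<in> {1..m}" and B_cells: "16 + n * m + 3 * m \<le> B" and B_n: "2 * n + m + 2 \<le> B"
begin

lemma B16: "16 \<le> B"
  using B_cells by simp

lemma cell_le_B: "i \<le> n + 2 \<Longrightarrow> d \<le> m \<Longrightarrow> cell m i d \<le> B"
  using cell_le[of i "n + 2" d m] B_cells by (simp add: algebra_simps)

subsection \<open>Reading the input\<close>

text \<open>The invariants of the loops: the last argument of each is the number of iterations done.\<close>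

definition read_entry_inv where
  "read_entry_inv P r k rest j = (\<lambda>(M, inp, out).
     M r_m = m \<and> M r_n = n \<and> M r_c = c \<and> M r_i = n - k \<and> M r_j = m - j \<and> M r_p = cell m (Suc k) 0 \<and>
     M r_count = 0 \<and>
     M r_s = of_bool (c \<notin> set (take j (ranking_list m r))) \<and>
     inp = drop j (ranking_list m r) @ rest \<and> out = [] \<and>
     (\<forall>d \<in> {1..m}. M (cell m 0 d) = supporters P d c +
        of_bool (d \<in> set (take j (ranking_list m r)) \<and> (d, c) \<in> r) \<and>
        (\<forall>i < length P. M (cell m (Suc i) d) = of_bool ((d, c) \<in> P ! i)) \<and>
        (d \<in> set (take j (ranking_list m r)) \<longrightarrow> M (cell m (Suc k) d) = of_bool ((d, c) \<in> r))))"

text \<open>\<open>P\<close> consists of the \<open>k\<close> rankings read completely, and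
  \<open>r\<close> is the one being read. Reading \<open>d\<close> changes just two table cells: the
  counter of \<open>d\<close> in row 0 and its entry in row \<open>Suc k\<close>.\<close>

lemma run_read_entry:
  assumes r: "is_ranking m r" and k: "length P = k" "k < n" and j: "j < m"
    and I: "read_entry_inv P r k rest j (M, inp, out)"
  shows "run B read_entry (M, inp, out) 11 (read_entry_inv P r k rest (Suc j))"
proof -
  define xs d where "xs = ranking_list m r" and "d = xs ! j"
  have len: "length xs = m" and dist: "distinct xs" and set: "set xs = {1..m}"
    by (simp_all add: xs_def length_ranking_list distinct_ranking_list set_ranking_list)
  have d: "d \<in> {1..m}" using set len j d_def nth_mem by metis
  have drop: "drop j xs = d # drop (Suc j) xs" using j len by (simp add: d_def Cons_nth_drop_Suc)
  have take: "set (take (Suc j) xs) = insert d (set (take j xs))"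
    using j len by (simp add: take_Suc_conv_app_nth d_def)
  \<comment> \<open>No candidate occurs twice in a ranking list, so the counter of \<open>d\<close>
    does not yet include \<open>r\<close>.\<close>
  have new: "d \<notin> set (take j xs)"
    using dist drop by (metis append_take_drop_id distinct_append disjoint_iff list.set_intros(1))
  have flag: "(d, c) \<in> r \<longleftrightarrow> c \<noteq> d \<and> c \<notin> set (take j xs)"
    using ranking_list_prefers_iff[OF r c j] take unfolding xs_def d_def by auto
  have irrefl: "(c, c) \<notin> r"
    using r by (auto simp: is_ranking_def strict_linear_order_on_def irrefl_def)
  have eq: "d - c + (c - d) = 0 \<longleftrightarrow> d = c" by auto
  have le: "supporters P d c \<le> k" using supporters_le_length[of P d c] k by simp
  have b: "cell m (Suc k) d \<le> B" "d + 16 \<le> B" "d - c + (c - d) \<le> B" "supporters P d c + 1 \<le> B"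
    using cell_le_B[of "Suc k" d] k d B_n B_cells le c by auto
  have cell0: "x + 16 = cell m 0 x" for x by (simp add: cell_def)
  have I': "M 2 = m" "M 3 = n" "M 4 = c" "M 5 = n - k" "M 6 = m - j" "M 7 = cell m (Suc k) 0"
    "M 15 = 0" "M 11 = of_bool (c \<notin> set (take j xs))" "inp = d # (drop (Suc j) xs @ rest)" "out = []"
    "M (cell m 0 d) = supporters P d c"
    and I'': "\<And>d. d \<in> {1..m} \<Longrightarrow> M (cell m 0 d) = supporters P d c +
        of_bool (d \<in> set (take j xs) \<and> (d, c) \<in> r) \<and>
        (\<forall>i < length P. M (cell m (Suc i) d) = of_bool ((d, c) \<in> P ! i)) \<and>
        (d \<in> set (take j xs) \<longrightarrow> M (cell m (Suc k) d) = of_bool ((d, c) \<in> r))"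
    using I d new unfolding read_entry_inv_def xs_def[symmetric] drop by auto
  \<comment> \<open>Reduces the new invariant to the registers and the two changed cells, so that
    the symbolic executions for \<open>d = c\<close> and \<open>d \<noteq> c\<close> end in the same
    obligations.\<close>
  have step: "read_entry_inv P r k rest (Suc j) (M', drop (Suc j) xs @ rest, [])"
    if "\<forall>x \<in> {2, 3, 4, 5, 7, 15}. M' x = M x" "M' 6 = m - Suc j" "M' 11 = of_bool ((d, c) \<in> r)"
      "M' (cell m (Suc k) d) = of_bool ((d, c) \<in> r)"
      "M' (cell m 0 d) = supporters P d c + of_bool ((d, c) \<in> r)"
      and frame: "\<And>i d'. d' \<in> {1..m} \<Longrightarrow> (i, d') \<noteq> (0, d) \<Longrightarrow> (i, d') \<noteq> (Suc k, d) \<Longrightarrow>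
        M' (cell m i d') = M (cell m i d')" for M'
  proof -
    have "M' (cell m 0 d') = supporters P d' c + of_bool (d' \<in> set (take (Suc j) xs) \<and> (d', c) \<in> r) \<and>
        (\<forall>i < length P. M' (cell m (Suc i) d') = of_bool ((d', c) \<in> P ! i)) \<and>
        (d' \<in> set (take (Suc j) xs) \<longrightarrow> M' (cell m (Suc k) d') = of_bool ((d', c) \<in> r))"
      if "d' \<in> {1..m}" for d'
      using I''[OF that] \<open>M' (cell m (Suc k) d) = _\<close> \<open>M' (cell m 0 d) = _\<close> k d that
      by (cases "d' = d") (simp_all add: take frame)
    moreover have "of_bool ((d, c) \<in> r) = (of_bool (c \<notin> set (take (Suc j) xs)) :: nat)"
      using flag take by auto
    ultimately show ?thesis
      using that(1-3) unfolding read_entry_inv_def xs_def[symmetric] by (simp add: I')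
  qed
  show ?thesis
  proof (rule run_wp[OF _ B16])
    show "consts_le 16 read_entry" by (simp add: read_entry_def)
    show "wp B read_entry (\<lambda>_. read_entry_inv P r k rest (Suc j)) 11 (M, inp, out)"
    proof (cases "d = c")
      case True
      then show ?thesis using b irrefl d
        by (auto simp: read_entry_def I' I'(11)[unfolded True] cell_add cell0 cell_neq cell_eq_iff
            intro!: step split: if_splits)
    next
      case False
      have "of_bool (c \<notin> set (take j xs)) = (of_bool ((d, c) \<in> r) :: nat)"
        using flag False by auto
      then show ?thesis using b False eq d
        by (auto simp: read_entry_def I' cell_add cell0 cell_neq cell_eq_iff simp del: add_is_0
            intro!: step split: if_splits)
    qed
  qed
qed

lemma run_read_ranking:
  assumes r: "is_ranking m r" and k: "length P = k" "k < n"
    and M: "M r_m = m" "M r_n = n" "M r_c = c" "M r_i = n - k" "M r_p = cell m (Suc k) 0" "M r_count = 0"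
    and t: "table m c P M"
  shows "run B read_ranking (M, ranking_list m r @ rest, []) (12 * m + 5)
    (\<lambda>(M', inp, out). M' r_m = m \<and> M' r_n = n \<and> M' r_c = c \<and> M' r_i = n - Suc k \<and>
       M' r_p = cell m (Suc (Suc k)) 0 \<and> M' r_count = 0 \<and> inp = rest \<and> out = [] \<and> table m c (P @ [r]) M')"
    (is "run B _ _ _ ?Q")
proof -
  have 1: "run B (Move (Dir r_s) (Const 1);; Move (Dir r_j) (R r_m)) (M, ranking_list m r @ rest, []) 2
      (read_entry_inv P r k rest 0)"
    by (rule run_wp[OF _ B16])
      (use t in \<open>auto simp: M read_entry_inv_def cell_neq table_def\<close>)
  have 2: "run B (While (R r_j) read_entry) s (m * (11 + 1) + 1) (read_entry_inv P r k rest m)"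
    if "read_entry_inv P r k rest 0 s" for s
    by (rule run_for[where I = "read_entry_inv P r k rest"])
      (use that B16 run_read_entry[OF r k] in \<open>auto simp: read_entry_inv_def\<close>)
  have 3: "run B (Add (Dir r_p) (R r_p) (R r_m);; Sub (Dir r_i) (R r_i) (Const 1)) s 2 ?Q"
    if "read_entry_inv P r k rest m s" for s
  proof -
    obtain M inp out where s: "s = (M, inp, out)" by (cases s)
    have I: "M r_m = m" "M r_n = n" "M r_c = c" "M r_i = n - k" "M r_p = cell m (Suc k) 0"
      "M r_count = 0" "inp = rest" "out = []"
      using that by (simp_all add: s read_entry_inv_def length_ranking_list)
    have "table m c (P @ [r]) M"
      using that k
      by (auto simp: s read_entry_inv_def table_def length_ranking_list set_ranking_list nth_append
          supporters_filter less_Suc_eq)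
    moreover have next_row: "cell m (Suc k) m = cell m (Suc (Suc k)) 0" by (simp add: cell_def)
    ultimately show ?thesis
      unfolding s using cell_le_B[of "Suc (Suc k)" 0] k
      by (intro run_wp[OF _ B16]) (auto simp: I cell_add elim: table_cong)
  qed
  show ?thesis
    unfolding read_ranking_def by (rule run_mono[OF run_Seq[OF 1 run_Seq[OF 2 3]]]) simp_all
qed

definition read_inv where
  "read_inv P k = (\<lambda>(M, inp, out). M r_m = m \<and> M r_n = n \<and> M r_c = c \<and> M r_i = n - k \<and>
     M r_p = cell m (Suc k) 0 \<and> M r_count = 0 \<and>
     inp = concat (map (ranking_list m) (drop k P)) \<and> out = [] \<and> table m c (take k P) M)"

text \<open>The memory starts with zeros, which is already the row of counters of the empty profile
  and the right initial \<open>r_count\<close>.\<close>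

lemma run_read_input:
  assumes P: "is_profile m P" "length P = n"
  shows "run B read_input (initial (encode m P c)) (n * (12 * m + 6) + 6) (read_inv P n)"
proof -
  have 1: "run B (Read (Dir r_m);; Read (Dir r_n);; Read (Dir r_c);;
      Add (Dir r_p) (R r_m) (Const 16);; Move (Dir r_i) (R r_n)) (initial (encode m P c)) 5 (read_inv P 0)"
    by (rule run_wp[OF _ B16]) (use P B_cells in
      \<open>auto simp: initial_def encode_def read_inv_def table_def supporters_filter cell_neq
         cell_def[of m "Suc 0" 0]\<close>)
  have "run B read_ranking (M, inp, out) (12 * m + 5) (read_inv P (Suc k))"
    if "k < n" "read_inv P k (M, inp, out)" for k M inp out
  proof -
    have "is_ranking m (P ! k)" using P that by (auto simp: is_profile_def)
    moreover have "drop k P = P ! k # drop (Suc k) P" using that P by (simp add: Cons_nth_drop_Suc)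
    moreover have "take (Suc k) P = take k P @ [P ! k]" using that P by (simp add: take_Suc_conv_app_nth)
    ultimately show ?thesis
      using run_read_ranking[of "P ! k" "take k P" k M "concat (map (ranking_list m) (drop (Suc k) P))"]
        that P by (auto simp: read_inv_def elim: run_mono)
  qed
  then have 2: "run B (While (R r_i) read_ranking) s (n * (12 * m + 5 + 1) + 1) (read_inv P n)"
    if "read_inv P 0 s" for s
    by (intro run_for[where I = "read_inv P"]) (use that B16 in \<open>auto simp: read_inv_def\<close>)
  show ?thesis
    unfolding read_input_def by (rule run_mono[OF run_Seq[OF 1 2]]) simp_all
qed

subsection \<open>Choosing a voter\<close>

definition score_entry_inv where
  "score_entry_inv P i M0 inp out j = (\<lambda>(M, inp', out'). inp' = inp \<and> out' = out \<and>
     M r_j = m - j \<and> M r_w = cell m 0 j \<and> M r_q = cell m (Suc i) j \<and>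
     M r_s = score j c P i \<and>
     (\<forall>a. a \<notin> {r_j, r_q, r_w, r_t, r_s} \<longrightarrow> M a = M0 a))"

lemma run_score_entry:
  assumes P: "length P \<le> n" "i < length P" and M0: "M0 r_n = length P" "table m c P M0"
    and j: "j < m" and I: "score_entry_inv P i M0 inp out j (M, inp', out')"
  shows "run B score_entry (M, inp', out') 7 (score_entry_inv P i M0 inp out (Suc j))"
proof (rule run_wp[OF _ B16])
  have I': "M r_j = m - j" "M r_w = cell m 0 j" "M r_q = cell m (Suc i) j"
    "M r_s = score j c P i" "inp' = inp" "out' = out"
    and frame: "\<And>a. a \<notin> {6, 8, 9, 10, 11} \<Longrightarrow> M a = M0 a"
    using I by (auto simp: score_entry_inv_def)
  have "M (cell m k (Suc j)) = M0 (cell m k (Suc j))" for k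
    by (rule frame) (auto simp: cell_def)
  moreover have "Suc j \<in> {1..m}" using j by simp
  ultimately have cells: "M (cell m 0 (Suc j)) = supporters P (Suc j) c"
    "M (cell m (Suc i) (Suc j)) = of_bool ((Suc j, c) \<in> P ! i)"
    using M0(2) P(2) unfolding table_def by auto
  have b: "cell m 0 (Suc j) \<le> B" "cell m (Suc i) (Suc j) \<le> B" "2 * supporters P (Suc j) c \<le> B"
    "score j c P i + 1 \<le> B"
    using cell_le_B[of 0 "Suc j"] cell_le_B[of "Suc i" "Suc j"] supporters_le_length[of P "Suc j" c]
      P j B_n score_le[of j c P i] by auto
  show "consts_le 16 score_entry" by (simp add: score_entry_def)
  show "wp B score_entry (\<lambda>_. score_entry_inv P i M0 inp out (Suc j)) 7 (M, inp', out')"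
    using b frame[of 3] M0(1)
    by (auto simp: score_entry_def score_entry_inv_def I' Suc_cell cells cell_neq score_Suc gains_def frame)
qed

text \<open>\<open>k\<close> is the number of voters scanned. While \<open>r_best\<close> is 0,
  \<open>r_index\<close> and \<open>r_row\<close> are arbitrary and may stem from an earlier
  round.\<close>

definition chosen :: "profile \<Rightarrow> nat \<Rightarrow> mem \<Rightarrow> bool" where
  "chosen P k M \<longleftrightarrow> (\<forall>i < k. score m c P i \<le> M r_best) \<and>
     (M r_best = 0 \<or> (\<exists>i < k. M r_index = Suc i \<and> M r_row = cell m (Suc i) 0 \<and> M r_best = score m c P i)) \<and>
     M r_p = cell m (Suc k) 0"

definition state_inv :: "profile \<Rightarrow> nat \<Rightarrow> mem \<Rightarrow> bool" where
  "state_inv P count M \<longleftrightarrow>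
     M r_m = m \<and> M r_n = length P \<and> M r_c = c \<and> M r_count = count \<and> table m c P M"

definition score_voter_inv where
  "score_voter_inv P count inp out k = (\<lambda>(M, inp', out'). inp' = inp \<and> out' = out \<and>
     state_inv P count M \<and> chosen P k M \<and> M r_i = length P - k)"

lemma run_score_voter:
  assumes P: "length P \<le> n" and k: "k < length P"
    and I: "score_voter_inv P count inp out k (M, inp', out')"
  shows "run B score_voter (M, inp', out') (8 * m + 12) (score_voter_inv P count inp out (Suc k))"
proof -
  have M: "M r_m = m" "M r_n = length P" "M r_c = c" "M r_count = count" "M r_i = length P - k"
    "M r_p = cell m (Suc k) 0" "inp' = inp" "out' = out" and t: "table m c P M" and ch: "chosen P k M"
    using I by (auto simp: score_voter_inv_def state_inv_def chosen_def)
  define M0 where "M0 = M"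
  have 1: "run B (Move (Dir r_s) (Const 0);; Move (Dir r_w) (Const 16);; Move (Dir r_q) (R r_p);;
      Move (Dir r_j) (R r_m)) (M, inp', out') 4 (score_entry_inv P k M0 inp out 0)"
    by (rule run_wp[OF _ B16]) (auto simp: M M0_def score_entry_inv_def score_0 cell_def[of m 0 0])
  have 2: "run B (While (R r_j) score_entry) s (m * (7 + 1) + 1) (score_entry_inv P k M0 inp out m)"
    if "score_entry_inv P k M0 inp out 0 s" for s
    by (rule run_for[where I = "score_entry_inv P k M0 inp out"])
      (use that B16 run_score_entry[OF P k, of M0] M t in \<open>auto simp: score_entry_inv_def M0_def\<close>)
  have 3: "run B (Sub (Dir r_t) (R r_s) (R r_best);; Sub (Dir r_i) (R r_i) (Const 1);;
      Cond (R r_t)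
        (Move (Dir r_best) (R r_s);; Sub (Dir r_index) (R r_n) (R r_i);; Move (Dir r_row) (R r_p))
        Skip;;
      Move (Dir r_p) (R r_q)) s 7 (score_voter_inv P count inp out (Suc k))"
    if s_inv: "score_entry_inv P k M0 inp out m s" for s
  proof -
    obtain M1 inp1 out1 where s: "s = (M1, inp1, out1)" by (cases s)
    have M1: "M1 8 = cell m (Suc k) m" "M1 11 = score m c P k" "inp1 = inp" "out1 = out"
      "\<And>a. a \<notin> {6, 8, 9, 10, 11} \<Longrightarrow> M1 a = M a"
      using s_inv by (auto simp: s score_entry_inv_def M0_def)
    have tab: "table m c P M'" if "\<And>a. 16 \<le> a \<Longrightarrow> M' a = M1 a" for M'
      using t by (rule table_cong) (simp add: that M1(5))
    have next_row: "cell m (Suc k) m = cell m (Suc (Suc k)) 0" by (simp add: cell_def)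
    \<comment> \<open>\<open>r_i\<close> is decremented before \<open>r_index\<close> is computed,
      so the difference is the number of voter \<open>k\<close> counted from 1.\<close>
    have index: "length P - (length P - k - 1) = Suc k" using k by simp
    show ?thesis
      unfolding s
      by (rule run_wp[OF _ B16])
        (use ch k in \<open>auto simp: M1 M next_row index score_voter_inv_def state_inv_def chosen_def
          less_Suc_eq intro!: tab\<close>)
  qed
  show ?thesis
    unfolding score_voter_def by (rule run_mono[OF run_Seq[OF 1 run_Seq[OF 2 3]]]) simp_all
qed

lemma run_choose_voter:
  assumes P: "length P \<le> n" and M: "state_inv P count M"
  shows "run B choose_voter (M, inp, out) (n * (8 * m + 13) + 4)
    (\<lambda>(M', inp', out'). inp' = inp \<and> out' = out \<and> state_inv P count M' \<and> chosen P (length P) M')"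
proof -
  have 1: "run B (Move (Dir r_best) (Const 0);; Add (Dir r_p) (R r_m) (Const 16);; Move (Dir r_i) (R r_n))
      (M, inp, out) 3 (score_voter_inv P count inp out 0)"
    by (rule run_wp[OF _ B16])
      (use M B_cells in \<open>auto simp: score_voter_inv_def state_inv_def chosen_def cell_def[of m "Suc 0" 0]
        elim: table_cong\<close>)
  have 2: "run B (While (R r_i) score_voter) s (length P * (8 * m + 12 + 1) + 1)
      (score_voter_inv P count inp out (length P))"
    if "score_voter_inv P count inp out 0 s" for s
    by (rule run_for[where I = "score_voter_inv P count inp out"])
      (use that B16 run_score_voter[OF P] in \<open>auto simp: score_voter_inv_def\<close>)
  \<comment> \<open>The cost in terms of the current profile is raised to one in terms of
    \<open>n\<close>, so that all rounds share one bound.\<close>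
  have "3 + (length P * (8 * m + 12 + 1) + 1) \<le> n * (8 * m + 13) + 4"
    using mult_le_mono1[OF P, of "8 * m + 13"] by (simp add: algebra_simps)
  then show ?thesis
    unfolding choose_voter_def
    by (intro run_mono[OF run_Seq[OF 1 2]]) (auto simp: score_voter_inv_def)
qed

subsection \<open>Deleting a voter\<close>

definition subtract_entry_inv where
  "subtract_entry_inv i M0 inp out j = (\<lambda>(M, inp', out'). inp' = inp \<and> out' = out \<and>
     M r_j = m - j \<and> M r_w = cell m 0 j \<and> M r_q = cell m (Suc i) j \<and>
     (\<forall>d \<in> {1..m}. M (cell m 0 d) = M0 (cell m 0 d) - (if d \<le> j then M0 (cell m (Suc i) d) else 0)) \<and>
     (\<forall>a. a \<notin> {r_j, r_q, r_w} \<and> a \<notin> cell m 0 ` {1..m} \<longrightarrow> M a = M0 a))"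

lemma run_subtract_entry:
  assumes i: "i < n" and j: "j < m" and I: "subtract_entry_inv i M0 inp out j (M, inp', out')"
  shows "run B subtract_entry (M, inp', out') 4 (subtract_entry_inv i M0 inp out (Suc j))"
proof (rule run_wp[OF _ B16])
  have I': "M r_j = m - j" "M r_w = cell m 0 j" "M r_q = cell m (Suc i) j" "inp' = inp" "out' = out"
    and W: "\<And>d. d \<in> {1..m} \<Longrightarrow>
        M (cell m 0 d) = M0 (cell m 0 d) - (if d \<le> j then M0 (cell m (Suc i) d) else 0)"
    and frame: "\<And>a. a \<notin> {6, 8, 9} \<Longrightarrow> a \<notin> cell m 0 ` {1..m} \<Longrightarrow> M a = M0 a"
    using I by (auto simp: subtract_entry_inv_def)
  have j': "Suc j \<in> {1..m}" using j by simp
  have "M (cell m 0 (Suc j)) = M0 (cell m 0 (Suc j))" using W[OF j'] by simp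
  moreover have "M (cell m (Suc i) (Suc j)) = M0 (cell m (Suc i) (Suc j))"
    by (rule frame) (use j' in \<open>auto simp: cell_neq cell_eq_iff\<close>)
  moreover have "cell m 0 (Suc j) \<le> B" "cell m (Suc i) (Suc j) \<le> B"
    using cell_le_B[of 0 "Suc j"] cell_le_B[of "Suc i" "Suc j"] i j by auto
  ultimately show "wp B subtract_entry (\<lambda>_. subtract_entry_inv i M0 inp out (Suc j)) 4 (M, inp', out')"
    using j' W frame
    by (auto simp: subtract_entry_def subtract_entry_inv_def I' Suc_cell cell_neq cell_eq_iff le_Suc_eq)
  show "consts_le 16 subtract_entry" by (simp add: subtract_entry_def)
qed

text \<open>Stated by addresses rather than by rows and columns, since \<open>j\<close> runs over
  the whole block behind the deleted row. Moving up by one row means reading from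
  \<open>a + m\<close>.\<close>

definition shift_entry_inv where
  "shift_entry_inv i l M0 inp out j = (\<lambda>(M, inp', out'). inp' = inp \<and> out' = out \<and>
     M r_j = l - j \<and> M r_row = cell m (Suc i) j \<and> M r_q = cell m (Suc (Suc i)) j \<and>
     (\<forall>a. a \<notin> {r_j, r_q, r_row} \<longrightarrow>
        M a = M0 (if cell m (Suc i) 0 < a \<and> a \<le> cell m (Suc i) j then a + m else a)))"

lemma run_shift_entry:
  assumes l: "cell m (Suc (Suc i)) l \<le> B" and j: "j < l"
    and I: "shift_entry_inv i l M0 inp out j (M, inp', out')"
  shows "run B shift_entry (M, inp', out') 4 (shift_entry_inv i l M0 inp out (Suc j))"
proof (rule run_wp[OF _ B16])
  have I': "M r_j = l - j" "M r_row = cell m (Suc i) j" "M r_q = cell m (Suc (Suc i)) j"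
    "inp' = inp" "out' = out"
    and frame: "\<And>a. a \<notin> {6, 8, 14} \<Longrightarrow>
        M a = M0 (if cell m (Suc i) 0 < a \<and> a \<le> cell m (Suc i) j then a + m else a)"
    using I by (auto simp: shift_entry_inv_def)
  have m: "1 \<le> m" using c by simp
  have next_row: "cell m (Suc i) d + m = cell m (Suc (Suc i)) d" for d by (simp add: cell_def)
  \<comment> \<open>The source lies beyond all cells overwritten so far, so copying in place in
    increasing order is safe.\<close>
  have "M (cell m (Suc (Suc i)) (Suc j)) = M0 (cell m (Suc (Suc i)) (Suc j))"
    using frame[of "cell m (Suc (Suc i)) (Suc j)"] m by (simp add: cell_def)
  moreover have "cell m (Suc i) (Suc j) \<le> B" "cell m (Suc (Suc i)) (Suc j) \<le> B"
    using l j by (simp_all add: cell_def)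
  moreover have "a \<le> cell m (Suc i) (Suc j) \<longleftrightarrow> a \<le> cell m (Suc i) j \<or> a = cell m (Suc i) (Suc j)"
    "cell m (Suc i) 0 < cell m (Suc i) (Suc j)" for a
    by (auto simp: cell_def)
  ultimately show "wp B shift_entry (\<lambda>_. shift_entry_inv i l M0 inp out (Suc j)) 4 (M, inp', out')"
    using frame
    by (auto simp: shift_entry_def shift_entry_inv_def I' Suc_cell cell_neq next_row)
  show "consts_le 16 shift_entry" by (simp add: shift_entry_def)
qed

text \<open>Subtracting the row of the deleted voter from row 0 corrects the counters, and the shift
  restores the numbering of rows. \<open>count + length P = n\<close> keeps both the counter of
  deletions and the addresses below \<open>B\<close>.\<close>

lemma run_delete_voter:
  assumes P: "count + length P = n"
    and M: "state_inv P count M" "chosen P (length P) M" "M r_best \<noteq> 0"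
  shows "\<exists>i < length P. score m c P i > 0 \<and> (\<forall>j < length P. score m c P j \<le> score m c P i) \<and>
    run B delete_voter (M, inp, out) (n * (5 * m) + 5 * m + 9) (\<lambda>(M', inp', out').
      inp' = inp \<and> out' = out @ [Suc i] \<and> state_inv (deletion (Suc i) P) (Suc count) M')"
proof -
  have M: "M r_m = m" "M r_n = length P" "M r_c = c" "M r_count = count"
      "M r_p = cell m (Suc (length P)) 0" and t: "table m c P M"
    using M by (simp_all add: state_inv_def chosen_def)
  obtain i where i: "i < length P" and index: "M r_index = Suc i" and row: "M r_row = cell m (Suc i) 0"
    and best: "score m c P i > 0" "\<forall>j < length P. score m c P j \<le> score m c P i"
    using assms(3,4) by (auto simp: chosen_def)
  define M0 where "M0 = M(r_count := Suc count)"
  \<comment> \<open>The number of cells behind the deleted row, which the program obtains as a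
    difference of two pointers.\<close>
  define l where "l = (length P - Suc i) * m"
  define out' where "out' = out @ [Suc i]"
  define M3 :: "mem \<Rightarrow> mem" where "M3 M2 = M2(r_j := l, r_n := length P - 1)" for M2
  have end_row: "cell m (Suc k) l = cell m (length P + k - i) 0" if "i \<le> Suc k" for k
  proof -
    have "Suc k + (length P - Suc i) = length P + k - i" using i that by simp
    then have "Suc k * m + l = (length P + k - i) * m"
      unfolding l_def by (metis add_mult_distrib)
    then show ?thesis by (simp add: cell_def)
  qed
  have next_row: "cell m (Suc k) m = cell m (Suc (Suc k)) 0"
    "cell m k d + m = cell m (Suc k) d" for k d by (simp_all add: cell_def)
  have 1: "run B (Write (R r_index);; Add (Dir r_count) (R r_count) (Const 1);;
      Move (Dir r_w) (Const 16);; Move (Dir r_q) (R r_row);; Move (Dir r_j) (R r_m))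
      (M, inp, out) 5 (subtract_entry_inv i M0 inp out' 0)"
    by (rule run_wp[OF _ B16])
      (use i P B_n in \<open>auto simp: M index row M0_def out'_def subtract_entry_inv_def cell_neq
        cell_def[of m 0 0]\<close>)
  have 2: "run B (While (R r_j) subtract_entry) s (m * (4 + 1) + 1) (subtract_entry_inv i M0 inp out' m)"
    if "subtract_entry_inv i M0 inp out' 0 s" for s
    by (rule run_for[where I = "subtract_entry_inv i M0 inp out'"])
      (use that B16 run_subtract_entry[of i] i P in \<open>auto simp: subtract_entry_inv_def\<close>)
  \<comment> \<open>The memory \<open>M2\<close> after the subtraction loop is carried along,
    because the shift describes the final table relative to it.\<close>
  have 3: "run B (Sub (Dir r_j) (R r_p) (R r_q);; Sub (Dir r_n) (R r_n) (Const 1)) s 2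
      (\<lambda>s'. \<exists>M2. subtract_entry_inv i M0 inp out' m (M2, inp, out') \<and>
         shift_entry_inv i l (M3 M2) inp out' 0 s')"
    if s_inv: "subtract_entry_inv i M0 inp out' m s" for s
  proof -
    obtain M2 inp2 out2 where s: "s = (M2, inp2, out2)" by (cases s)
    have M2: "inp2 = inp" "out2 = out'" "M2 8 = cell m (Suc (Suc i)) 0"
      "\<And>a. a < 16 \<Longrightarrow> a \<notin> {6, 8, 9} \<Longrightarrow> M2 a = M0 a"
      using s_inv next_row by (auto simp: s subtract_entry_inv_def cell_neq image_iff)
    have l: "cell m (Suc (length P)) 0 - cell m (Suc (Suc i)) 0 = l"
      using i by (simp add: cell_def l_def diff_mult_distrib)
    show ?thesis
      unfolding s
      by (rule run_wp[OF _ B16])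
        (use s_inv in \<open>auto simp: s M2 M M0_def row l M3_def shift_entry_inv_def intro!: exI[of _ M2]\<close>)
  qed
  have 4: "run B (While (R r_j) shift_entry) s (l * (4 + 1) + 1)
      (\<lambda>(M', inp', out''). inp' = inp \<and> out'' = out' \<and> state_inv (deletion (Suc i) P) (Suc count) M')"
    if "\<exists>M2. subtract_entry_inv i M0 inp out' m (M2, inp, out') \<and> shift_entry_inv i l (M3 M2) inp out' 0 s"
    for s
  proof -
    from that obtain M2 where sub: "subtract_entry_inv i M0 inp out' m (M2, inp, out')"
      and sh: "shift_entry_inv i l (M3 M2) inp out' 0 s" by blast
    have W: "M2 (cell m 0 d) = M0 (cell m 0 d) - M0 (cell m (Suc i) d)" if "d \<in> {1..m}" for d
      using sub that by (simp add: subtract_entry_inv_def)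
    have frame: "M2 a = M0 a" if "a \<notin> {6, 8, 9}" "a \<notin> cell m 0 ` {1..m}" for a
      using sub that by (simp add: subtract_entry_inv_def)
    have "cell m (Suc (Suc i)) l \<le> B"
      using end_row[of "Suc i"] cell_le_B[of "Suc (length P)" 0] P by simp
    then have "run B (While (R r_j) shift_entry) s (l * (4 + 1) + 1) (shift_entry_inv i l (M3 M2) inp out' l)"
      by (intro run_for[where I = "shift_entry_inv i l (M3 M2) inp out'"])
        (use sh B16 run_shift_entry in \<open>auto simp: shift_entry_inv_def\<close>)
    then show ?thesis
    proof (rule run_mono[OF _ order_refl])
      fix s' assume sh': "shift_entry_inv i l (M3 M2) inp out' l s'"
      obtain M' inp' out'' where s': "s' = (M', inp', out'')" by (cases s')
      have M': "M' a = M3 M2 (if cell m (Suc i) 0 < a \<and> a \<le> cell m (Suc i) l then a + m else a)"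
        if "a \<notin> {6, 8, 14}" for a
        using sh' that by (simp add: s' shift_entry_inv_def)
      have regs: "M' a = M3 M2 a" if "a < 16" "a \<notin> {6, 8, 14}" for a
        using M'[of a] that by (simp add: cell_def)
      have regs2: "M2 a = M0 a" if "a < 16" "a \<notin> {6, 8, 9}" for a
        using frame[of a] that by (auto simp: cell_def)
      \<comment> \<open>The copied block ends at \<open>cell m (length P) 0\<close>, which is the
        end of row \<open>length P - 1\<close>, the last row of the new table.\<close>
      have M'_cell: "M' (cell m k d) =
          M2 (if cell m (Suc i) 0 < cell m k d \<and> cell m k d \<le> cell m (length P) 0
              then cell m (Suc k) d else cell m k d)" for k d
        using M'[of "cell m k d"] end_row[of i] next_row by (simp add: M3_def cell_neq)
      have M2_cell: "M2 (cell m (Suc k) d) = of_bool ((d, c) \<in> P ! k)"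
        if "k < length P" "d \<in> {1..m}" for k d
      proof -
        have "cell m (Suc k) d \<notin> cell m 0 ` {1..m}" using that(2) by (auto simp: cell_eq_iff)
        then have "M2 (cell m (Suc k) d) = M0 (cell m (Suc k) d)"
          by (intro frame) (auto simp: cell_neq)
        then show ?thesis using t that by (simp add: M0_def cell_neq table_def)
      qed
      have "table m c (deletion (Suc i) P) M'"
        unfolding table_def
      proof (intro ballI conjI allI impI)
        fix d assume d: "d \<in> {1..m}"
        have "cell m 0 d \<le> cell m (Suc i) 0" using cell_le_row d by simp
        then have "M' (cell m 0 d) = M0 (cell m 0 d) - M0 (cell m (Suc i) d)"
          using M'_cell[of 0 d] W[OF d] by simp
        also have "\<dots> = supporters P d c - of_bool ((d, c) \<in> P ! i)"
          using t d i by (simp add: M0_def cell_neq table_def)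
        finally show "M' (cell m 0 d) = supporters (deletion (Suc i) P) d c"
          using supporters_deletion[OF i, of d c] by simp
        fix k assume "k < length (deletion (Suc i) P)"
        then have k: "k < length P - 1" using i by (simp add: length_deletion)
        show "M' (cell m (Suc k) d) = of_bool ((d, c) \<in> deletion (Suc i) P ! k)"
        proof (cases "k < i")
          case True
          then have "cell m (Suc k) d \<le> cell m (Suc i) 0" using cell_le_row d by simp
          then show ?thesis using M'_cell[of "Suc k" d] M2_cell[of k d] k d True i
            by (simp add: nth_deletion)
        next
          case False
          then have "cell m (Suc i) 0 < cell m (Suc k) d"
            using mult_le_mono1[of "Suc i" "Suc k" m] False d
            unfolding cell_def atLeastAtMost_iff by linarith
          moreover have "cell m (Suc k) d \<le> cell m (length P) 0" using cell_le_row d k by simp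
          ultimately show ?thesis using M'_cell[of "Suc k" d] M2_cell[of "Suc k" d] k d False i
            by (simp add: nth_deletion)
        qed
      qed
      then show "case s' of (M', inp', out'') \<Rightarrow>
          inp' = inp \<and> out'' = out' \<and> state_inv (deletion (Suc i) P) (Suc count) M'"
        using sh' i
        by (simp add: s' state_inv_def shift_entry_inv_def regs regs2 M3_def M0_def M
            length_deletion)
    qed
  qed
  have "l \<le> n * m" unfolding l_def using P by (intro mult_le_mono1) simp
  then have "5 + (m * (4 + 1) + 1 + (2 + (l * (4 + 1) + 1))) \<le> n * (5 * m) + 5 * m + 9" by simp
  from run_mono[OF run_Seq[OF 1 run_Seq[OF 2 run_Seq[OF 3 4]]] this] i best show ?thesis
    unfolding delete_voter_def out'_def by blast
qed

text \<open>Each round removes a voter, so the induction is on the number of voters left.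
  \<open>out\<close> and \<open>count\<close> are generalized since both accumulate. A round costs
  at most one deletion, one choice and one test, which add up to the factor of
  \<open>length P\<close>.\<close>

lemma run_main_loop:
  assumes "is_profile m P" "count + length P = n" "state_inv P count M" "chosen P (length P) M"
  shows "run B (While (R r_best) (delete_voter;; choose_voter)) (M, inp, out)
    (length P * (n * (13 * m + 13) + 5 * m + 14) + 1)
    (\<lambda>(M', inp', out'). \<exists>S. greedy_young m c P S \<and> out' = out @ S \<and> M' r_count = count + length S)"
  using assms
proof (induction "length P" arbitrary: P count M out)
  case (0 P)
  \<comment> \<open>With no voter to refer to, \<open>chosen\<close> forces \<open>r_best\<close> to
    be 0.\<close>
  then have "M r_best = 0" "\<not> deficit m P c > 0"
    using deficit_pos_iff[OF 0(2) c] by (auto simp: chosen_def)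
  then show ?case
    using B16 0 greedy_young.stop by (intro run_mono[OF run_WhileF]) (auto simp: state_inv_def)
next
  case (Suc l P)
  show ?case
  proof (cases "M r_best = 0")
    case True
    then have "\<not> deficit m P c > 0"
      using deficit_pos_iff[OF Suc.prems(1) c] Suc.prems(4) by (auto simp: chosen_def)
    then show ?thesis
      using B16 True Suc.prems greedy_young.stop
      by (intro run_mono[OF run_WhileF]) (auto simp: state_inv_def)
  next
    case False
    from run_delete_voter[OF Suc.prems(2-4) False, of inp out] obtain i where
      i: "i < length P" "score m c P i > 0" "\<forall>j < length P. score m c P j \<le> score m c P i" and
      del: "run B delete_voter (M, inp, out) (n * (5 * m) + 5 * m + 9) (\<lambda>(M', inp', out').
        inp' = inp \<and> out' = out @ [Suc i] \<and> state_inv (deletion (Suc i) P) (Suc count) M')"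
      by blast
    let ?P = "deletion (Suc i) P"
    have len: "length ?P = l" using length_deletion[OF i(1)] Suc.hyps(2) by simp
    have "run B (delete_voter;; choose_voter) (M, inp, out)
        ((n * (5 * m) + 5 * m + 9) + (n * (8 * m + 13) + 4))
        (\<lambda>(M', inp', out'). inp' = inp \<and> out' = out @ [Suc i] \<and> state_inv ?P (Suc count) M' \<and>
           chosen ?P (length ?P) M')"
      using run_choose_voter[of ?P "Suc count"] Suc.prems(2) Suc.hyps(2) len
      by (intro run_Seq[OF del]) (fastforce elim: run_mono)
    then have "run B (While (R r_best) (delete_voter;; choose_voter)) (M, inp, out)
        ((n * (5 * m) + 5 * m + 9) + (n * (8 * m + 13) + 4) + 1 +
          (length ?P * (n * (13 * m + 13) + 5 * m + 14) + 1))
        (\<lambda>(M', inp', out'). \<exists>S. greedy_young m c ?P S \<and> out' = (out @ [Suc i]) @ S \<and>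
           M' r_count = Suc count + length S)"
    proof (rule run_WhileT[rotated 2])
      fix s' assume s': "case s' of (M', inp', out') \<Rightarrow> inp' = inp \<and> out' = out @ [Suc i] \<and>
        state_inv ?P (Suc count) M' \<and> chosen ?P (length ?P) M'"
      obtain M' inp' out' where "s' = (M', inp', out')" by (cases s')
      with s' show "run B (While (R r_best) (delete_voter;; choose_voter)) s'
        (length ?P * (n * (13 * m + 13) + 5 * m + 14) + 1)
        (\<lambda>(M', inp', out'). \<exists>S. greedy_young m c ?P S \<and> out' = (out @ [Suc i]) @ S \<and>
           M' r_count = Suc count + length S)"
        using Suc.hyps(1)[of ?P "Suc count" M' "out @ [Suc i]"] is_profile_deletion[OF Suc.prems(1)]
          Suc.prems(2) Suc.hyps(2) len by simp
    qed (use False B16 in auto)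
    then show ?thesis
    proof (rule run_mono)
      show "(n * (5 * m) + 5 * m + 9) + (n * (8 * m + 13) + 4) + 1 +
          (length ?P * (n * (13 * m + 13) + 5 * m + 14) + 1)
          \<le> length P * (n * (13 * m + 13) + 5 * m + 14) + 1"
        unfolding len Suc.hyps(2)[symmetric] by (simp add: algebra_simps)
      fix s' assume "case s' of (M', inp', out') \<Rightarrow> \<exists>S. greedy_young m c ?P S \<and>
        out' = (out @ [Suc i]) @ S \<and> M' r_count = Suc count + length S"
      then obtain M' inp' out' S where "s' = (M', inp', out')" "greedy_young m c ?P S"
        "out' = out @ Suc i # S" "M' r_count = count + length (Suc i # S)"
        by (cases s') auto
      with greedy_young_step[OF Suc.prems(1) c i]
      show "case s' of (M', inp', out') \<Rightarrow> \<exists>S. greedy_young m c P S \<and> out' = out @ S \<and>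
        M' r_count = count + length S"
        by blast
    qed
  qed
qed

lemma run_program:
  assumes P: "is_profile m P" "length P = n"
  shows "run B program (initial (encode m P c))
    (n * (12 * m + 6) + 6 + (n * (8 * m + 13) + 4 + (n * (n * (13 * m + 13) + 5 * m + 14) + 1 + 1)))
    (\<lambda>s. \<exists>S. greedy_young m c P S \<and> printed s = S @ [length S])"
proof -
  have 1: "run B choose_voter s (n * (8 * m + 13) + 4)
      (\<lambda>(M, inp, out). out = [] \<and> state_inv P 0 M \<and> chosen P n M)" if s: "read_inv P n s" for s
  proof -
    obtain M inp where "s = (M, inp, [])" "state_inv P 0 M"
      using s P by (cases s) (auto simp: read_inv_def state_inv_def)
    with run_mono[OF run_choose_voter[of P 0 M inp "[]"]] P show ?thesis by auto
  qed
  have 2: "run B (While (R r_best) (delete_voter;; choose_voter)) s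
      (n * (n * (13 * m + 13) + 5 * m + 14) + 1)
      (\<lambda>(M, inp, out). \<exists>S. greedy_young m c P S \<and> out = S \<and> M r_count = length S)"
    if "case s of (M, inp, out) \<Rightarrow> out = [] \<and> state_inv P 0 M \<and> chosen P n M" for s
    using run_main_loop[OF P(1), where count = 0 and out = "[]"] that P by (cases s) auto
  have 3: "run B (Write (R r_count)) s 1 (\<lambda>s. \<exists>S. greedy_young m c P S \<and> printed s = S @ [length S])"
    if "case s of (M, inp, out) \<Rightarrow> \<exists>S. greedy_young m c P S \<and> out = S \<and> M r_count = length S" for s
    using that by (cases s) (auto intro!: run_wp[OF _ B16] simp: printed_def)
  show ?thesis
    unfolding program_def by (rule run_Seq[OF run_read_input[OF P] run_Seq[OF 1 run_Seq[OF 2 3]]])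
qed

end

section \<open>The running time\<close>

lemma length_le_input_length: "length w \<le> input_length w"
  by (induction w) (auto simp: input_length_def bit_size_def)

lemma length_encode: "length (encode m P c) = 3 + length P * m"
proof -
  have "length (concat (map (ranking_list m) P)) = length P * m"
    by (induction P) (auto simp: length_ranking_list)
  then show ?thesis by (simp add: encode_def)
qed

lemma set_encode: "c \<in> {1..m} \<Longrightarrow> x \<in> set (encode m P c) \<Longrightarrow> x \<le> m \<or> x = length P"
  by (auto simp: encode_def set_ranking_list split: if_splits)

text \<open>32 is a power of two that absorbs the coefficients of \<open>B\<close>, whose sum is 24;
  multiplying by it adds exactly 5 bits.\<close>

lemma bit_size_32: "x > 0 \<Longrightarrow> bit_size (32 * x) = bit_size x + 5"
proof -
  have "floor_log (2 * y) = Suc (floor_log y)" if "y > 0" for y using that by simp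
  from this[of x] this[of "2 * x"] this[of "2 * (2 * x)"] this[of "2 * (2 * (2 * x))"]
    this[of "2 * (2 * (2 * (2 * x)))"]
  show "x > 0 \<Longrightarrow> bit_size (32 * x) = bit_size x + 5" by (simp add: bit_size_def)
qed

text \<open>The constant 4608 is \<open>96 * 48\<close>: at most \<open>96 * N ^ 2\<close> units,
  each costing \<open>8 * bit_size B\<close>, which is at most
  \<open>48 * bit_size N\<close>.\<close>

lemma program_correct:
  assumes P: "is_profile m P" and c: "c \<in> {1..m}"
  defines "N \<equiv> input_length (encode m P c)"
  shows "\<exists>t s S. exec program (initial (encode m P c)) t s \<and> greedy_young m c P S \<and>
    printed s = S @ [length S] \<and> t \<le> 4608 * (N ^ 2 * bit_size N)"
proof -
  define n B where "n = length P" and "B = 18 + n * m + 3 * m + 2 * n"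
  define K where "K = n * (12 * m + 6) + 6 + (n * (8 * m + 13) + 4 +
    (n * (n * (13 * m + 13) + 5 * m + 14) + 1 + 1))"
  have m: "1 \<le> m" using c by simp
  interpret machine m c n B
    using c by unfold_locales (simp_all add: B_def)
  have "\<forall>x \<in> set (encode m P c). x \<le> B"
    using set_encode[OF c, of _ P] by (force simp: B_def n_def)
  then have "bounded B (initial (encode m P c))" by (simp add: bounded_def initial_def)
  with run_program[OF P n_def[symmetric]] obtain t s S where
    "exec program (initial (encode m P c)) t s" "t \<le> K * (8 * bit_size B)"
    "greedy_young m c P S" "printed s = S @ [length S]"
    unfolding run_def K_def by blast
  moreover have "K * (8 * bit_size B) \<le> 4608 * (N ^ 2 * bit_size N)"
  proof (cases "n = 0")
    \<comment> \<open>No ranking is present, so \<open>N\<close> need not exceed a multiple of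
      \<open>m\<close>. But \<open>m\<close> itself is written in the input, which gives
      \<open>bit_size m \<le> N\<close>, and \<open>K\<close> is constant.\<close>
    case True
    have "bit_size B \<le> bit_size (32 * m)" using True m by (intro bit_size_mono) (simp add: B_def)
    also have "\<dots> = bit_size m + 5" using m by (intro bit_size_32) simp
    also have "bit_size m \<le> N" by (simp add: N_def input_length_def encode_def)
    finally have B: "bit_size B \<le> N + 5" by simp
    have "1 \<le> N" using length_le_input_length[of "encode m P c"] by (simp add: N_def length_encode)
    then have "1 \<le> N" "N \<le> N ^ 2 * bit_size N"
      using bit_size_pos[of N] mult_le_mono[of N "N ^ 2" 1 "bit_size N"] self_le_power[of N 2] by auto
    then have "12 * (8 * bit_size B) \<le> 4608 * (N ^ 2 * bit_size N)" using B by linarith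
    moreover have "K = 12" using True by (simp add: K_def)
    ultimately show ?thesis by simp
  next
    case False
    define a where "a = n * m"
    have a: "n \<le> a" "m \<le> a" "1 \<le> a" using False m by (simp_all add: a_def)
    have aN: "a \<le> N"
      using length_le_input_length[of "encode m P c"] by (simp add: N_def length_encode a_def n_def)
    have "bit_size B \<le> bit_size (32 * N)"
      using a aN by (intro bit_size_mono) (simp add: B_def a_def[symmetric])
    also have "\<dots> = bit_size N + 5" using a aN by (intro bit_size_32) simp
    also have "\<dots> \<le> 6 * bit_size N" using bit_size_pos[of N] by simp
    finally have B: "8 * bit_size B \<le> 48 * bit_size N" by simp
    have "n * n \<le> a * a" "n * a \<le> a * a" "a \<le> a * a" "1 \<le> a * a"
      using a by (simp_all add: mult_le_mono)
    moreover have "K = 13 * (n * a) + 13 * (n * n) + 25 * a + 33 * n + 12"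
      by (simp add: K_def a_def algebra_simps)
    \<comment> \<open>96 is the sum of the coefficients 13, 13, 25, 33 and 12, since every term is
      at most its coefficient times \<open>a * a\<close>.\<close>
    ultimately have "K \<le> 96 * (a * a)" using a by linarith
    also have "\<dots> \<le> 96 * N ^ 2" using aN by (simp add: power2_eq_square mult_le_mono)
    finally show ?thesis using mult_le_mono[OF _ B, of K "96 * N ^ 2"] by simp
  qed
  ultimately show ?thesis by (meson le_trans)
qed

text \<open>For \<open>N \<ge> 2\<close> the additive 1 in \<open>bit_size\<close> is at most the
  binary logarithm of \<open>N\<close>, hence the factor 2. At \<open>N = 1\<close> the logarithm
  vanishes while \<open>bit_size\<close> is 1.\<close>

lemma bit_size_le_ln: "2 \<le> N \<Longrightarrow> real (bit_size N) \<le> 2 / ln 2 * ln (real N)"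
proof -
  assume N: "2 \<le> N"
  have "2 ^ floor_log N \<le> N" using N floor_log_exp2_le[of N] by simp
  then have "(2::real) ^ floor_log N \<le> real N" by (metis of_nat_le_iff of_nat_numeral of_nat_power)
  then have "ln ((2::real) ^ floor_log N) \<le> ln (real N)" using N by (subst ln_le_cancel_iff) auto
  then have "real (floor_log N) * ln 2 \<le> ln (real N)" by (simp add: ln_realpow)
  moreover have "ln 2 \<le> ln (real N)" using N by simp
  ultimately have "real (bit_size N) * ln 2 \<le> 2 * ln (real N)" by (simp add: bit_size_def algebra_simps)
  then show "real (bit_size N) \<le> 2 / ln 2 * ln (real N)" by (simp add: field_simps)
qed

theorem theorem4:
  "\<exists>p T. implements_greedy_young p \<and> runs_in_time p T \<and>
     T \<in> O(\<lambda>N. real N ^ 2 * ln (real N))"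
proof (intro exI conjI)
  let ?T = "\<lambda>N. real (4608 * (N ^ 2 * bit_size N))"
  show "implements_greedy_young program"
    unfolding implements_greedy_young_def using program_correct by blast
  show "runs_in_time program ?T"
    unfolding runs_in_time_def of_nat_le_iff using program_correct by blast
  show "?T \<in> O(\<lambda>N. real N ^ 2 * ln (real N))"
  proof (rule bigoI)
    show "\<forall>\<^sub>F N in at_top. norm (?T N) \<le> 4608 * (2 / ln 2) * norm (real N ^ 2 * ln (real N))"
      using eventually_ge_at_top[of 2]
    proof eventually_elim
      case (elim N)
      have "real N ^ 2 * real (bit_size N) \<le> real N ^ 2 * (2 / ln 2 * ln (real N))"
        using bit_size_le_ln[OF elim] by (intro mult_left_mono) auto
      then show ?case using elim by (simp add: abs_mult)
    qed
  qed
qed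

end
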